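(* Let $R$ be an integrally closed Noetherian ring. Then $R$ is a general Krull ring if and only if $T(R)$ is a principal ideal ring.
   Context: All rings are commutative with nonzero identity. $T(R)$ is the total quotient ring of $R$; $R$ is integrally closed if it is integrally closed in $T(R)$. A special primary ring (SPR) is a local ring whose maximal ideal $M$ is principal and satisfies $M^n = (0)$ for some $n \geq 1$ (so a field is an SPR). A general Krull ring is a finite direct product of Krull domains and SPRs (a field counts as a Krull domain). A principal ideal ring is a ring all of whose ideals are principal. *)

theory Defs
  imports "HOL-Algebra.Algebra"
begin

definition nonzerodivisors :: "('a, 'b) ring_scheme \<Rightarrow> 'a set"
  where "nonzerodivisors R =
    {s \<in> carrier R. \<forall>a \<in> carrier R. a \<otimes>\<^bsub>R\<^esub> s = \<zero>\<^bsub>R\<^esub> \<longrightarrow> a = \<zero>\<^bsub>R\<^esub>}"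

text \<open>The fraction \<open>a / s\<close> is the set of all pairs \<open>(b, t)\<close> with \<open>t\<close> a non-zero-divisor
  and \<open>a t = b s\<close>. As the denominators are non-zero-divisors, no further factor is needed to
  make this an equivalence class.\<close>

definition fraction :: "('a, 'b) ring_scheme \<Rightarrow> 'a \<Rightarrow> 'a \<Rightarrow> ('a \<times> 'a) set"
  where "fraction R a s =
    {(b, t). b \<in> carrier R \<and> t \<in> nonzerodivisors R \<and> a \<otimes>\<^bsub>R\<^esub> t = b \<otimes>\<^bsub>R\<^esub> s}"

text \<open>In the operations below all the fractions under the union are equal (they do not depend
  on the chosen representatives), so the union is just that common value.\<close>

definition total_quotient_ring :: "('a, 'b) ring_scheme \<Rightarrow> ('a \<times> 'a) set ring"
  where "total_quotient_ring R =
    \<lparr> carrier = {fraction R a s | a s. a \<in> carrier R \<and> s \<in> nonzerodivisors R},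
      monoid.mult = (\<lambda>A B. \<Union>{fraction R (a \<otimes>\<^bsub>R\<^esub> b) (s \<otimes>\<^bsub>R\<^esub> t) | a s b t.
        (a, s) \<in> A \<and> (b, t) \<in> B}),
      monoid.one = fraction R \<one>\<^bsub>R\<^esub> \<one>\<^bsub>R\<^esub>,
      ring.zero = fraction R \<zero>\<^bsub>R\<^esub> \<one>\<^bsub>R\<^esub>,
      ring.add = (\<lambda>A B. \<Union>{fraction R (a \<otimes>\<^bsub>R\<^esub> t \<oplus>\<^bsub>R\<^esub> b \<otimes>\<^bsub>R\<^esub> s) (s \<otimes>\<^bsub>R\<^esub> t) | a s b t.
        (a, s) \<in> A \<and> (b, t) \<in> B}) \<rparr>"

definition to_total_quotient :: "('a, 'b) ring_scheme \<Rightarrow> 'a \<Rightarrow> ('a \<times> 'a) set"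
  where "to_total_quotient R a = fraction R a \<one>\<^bsub>R\<^esub>"

definition integral_over :: "('a, 'b) ring_scheme \<Rightarrow> 'a set \<Rightarrow> 'a \<Rightarrow> bool"
  where "integral_over S A x \<longleftrightarrow>
    (\<exists>p \<in> carrier (univ_poly S A). p \<noteq> [] \<and> lead_coeff p = \<one>\<^bsub>S\<^esub> \<and> ring.eval S p x = \<zero>\<^bsub>S\<^esub>)"

definition integrally_closed :: "('a, 'b) ring_scheme \<Rightarrow> bool"
  where "integrally_closed R \<longleftrightarrow>
    (\<forall>x \<in> carrier (total_quotient_ring R).
      integral_over (total_quotient_ring R) (to_total_quotient R ` carrier R) x
        \<longrightarrow> x \<in> to_total_quotient R ` carrier R)"

locale principal_ideal_ring = cring +
  assumes all_ideals_principal: "ideal I R \<Longrightarrow> principalideal I R"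

text \<open>Powers of ideals are taken in the multiplicative monoid of \<open>ideals_set R\<close>, whose
  multiplication is the product of ideals and whose unit is \<open>carrier R\<close>.\<close>

locale special_primary_ring = cring +
  assumes local_nilpotent_principal:
    "\<exists>M. maximalideal M R \<and> (\<forall>M'. maximalideal M' R \<longrightarrow> M' = M) \<and> principalideal M R \<and>
      (\<exists>n::nat. n \<ge> 1 \<and> M [^]\<^bsub>ideals_set R\<^esub> n = {\<zero>})"

text \<open>Discrete valuations of rank one, normalised to have value group \<open>\<int>\<close>. The value at
  \<open>\<zero>\<close> (mathematically infinity) is left unspecified.\<close>

locale discrete_valuation = field K for K (structure) +
  fixes v :: "'a \<Rightarrow> int"
  assumes onto: "v ` (carrier K - {\<zero>}) = UNIV"
    and val_mult: "\<lbrakk>x \<in> carrier K - {\<zero>}; y \<in> carrier K - {\<zero>}\<rbrakk> \<Longrightarrow> v (x \<otimes> y) = v x + v y"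
    and val_add: "\<lbrakk>x \<in> carrier K - {\<zero>}; y \<in> carrier K - {\<zero>}; x \<oplus> y \<noteq> \<zero>\<rbrakk>
      \<Longrightarrow> v (x \<oplus> y) \<ge> min (v x) (v y)"

text \<open>A Krull domain is an intersection, of finite character, of discrete valuation rings of
  its quotient field. The set \<open>W\<close> of valuations may be empty, so fields are included.\<close>

definition krull_domain :: "('a, 'b) ring_scheme \<Rightarrow> bool"
  where "krull_domain D \<longleftrightarrow> domain D \<and>
    (let K = total_quotient_ring D in
      \<exists>W. (\<forall>v \<in> W. discrete_valuation K v) \<and>
        to_total_quotient D ` carrier D
          = {x \<in> carrier K. x = \<zero>\<^bsub>K\<^esub> \<or> (\<forall>v \<in> W. v x \<ge> 0)} \<and>
        (\<forall>x \<in> carrier K - {\<zero>\<^bsub>K\<^esub>}. finite {v \<in> W. v x \<noteq> 0}))"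

text \<open>Each factor of a finite direct product embeds (as a set) into the product, so requiring
  the factors to live on the type of the elements of \<open>R\<close> is no restriction.\<close>

definition general_krull_ring :: "('a, 'b) ring_scheme \<Rightarrow> bool"
  where "general_krull_ring R \<longleftrightarrow> cring R \<and>
    (\<exists>Rs :: 'a ring list. Rs \<noteq> [] \<and>
      (\<forall>S \<in> set Rs. krull_domain S \<or> special_primary_ring S) \<and> R \<simeq> RDirProd_list Rs)"

end

theory Submission
  imports Defs
begin

text \<open>Both directions pass through a condition on \<open>R\<close> alone: every ideal \<open>I\<close> contains an \<open>a\<close>
  such that \<open>I T(R) = a T(R)\<close>. It is equivalent to \<open>T(R)\<close> being principal, holds for domains and
  for special primary rings, and is stable under finite products, which settles one direction.

  Conversely, in a Noetherian ring integral closedness yields complete integral closedness, and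
  these conditions pass to the corner rings \<open>e R\<close>. Noetherianness splits \<open>R\<close> into finitely many
  corners without non-trivial idempotents. There every element is regular or nilpotent, since
  otherwise a power \<open>p\<close> of it and a generator \<open>q\<close> of its annihilator satisfy
  \<open>1 \<in> ((p) : (q)) + ((q) : (p))\<close> in \<open>T(R)\<close> and \<open>(p) \<inter> (q) = 0\<close>, which produces an idempotent.
  A non-zero nilpotent can be divided by every regular element; by the ascending chain condition
  regular elements are then units and the corner is a special primary ring. Otherwise the corner
  is a domain, and the valuations of its quotient field \<open>K\<close> are read off directly from elements
  \<open>x \<in> K\<close> whose conductor \<open>(R : x)\<close> is a proper prime ideal \<open>P\<close>: the value of \<open>y\<close> is the number of
  times \<open>y\<close> can be multiplied by \<open>x\<close> without leaving \<open>R\<close>, and the result then lies outside \<open>P\<close>.\<close>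

section \<open>Non-zero-divisors and total quotient rings\<close>

text \<open>The relation \<open>s x = r a\<close> with \<open>s\<close> regular says that
  \<open>x\<close> is the multiple \<open>(r / s) a\<close> in T(R). Keeping it in this form means
  that no map between total quotient rings of different rings is needed when passing to products,
  isomorphic copies or corners.

  Complete integral closedness is preferred to integral closedness because a fraction is brought
  into the ring by exhibiting one regular common denominator of all its powers, with no polynomial
  to find. It is used in this way three times: an idempotent \<open>t / s\<close> of T(R) has the
  common denominator \<open>s\<close>; the quotient of a nilpotent by a regular \<open>s\<close> has
  a power of \<open>s\<close>; and a pole would lie in the ring if some non-zero \<open>y\<close>
  stayed inside under all powers of it.

  The idempotent of the connected case is at first only an element of T(R), and it exists because
  the power \<open>p\<close> is chosen so high that \<open>p\<close> and its square have the same
  annihilator: this is what makes (p) and (q) meet in zero.\<close>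

definition generically_principal :: "('a, 'b) ring_scheme \<Rightarrow> bool"
  where "generically_principal R \<longleftrightarrow> (\<forall>I. ideal I R \<longrightarrow>
    (\<exists>a \<in> I. \<forall>x \<in> I. \<exists>s \<in> nonzerodivisors R. \<exists>r \<in> carrier R. s \<otimes>\<^bsub>R\<^esub> x = r \<otimes>\<^bsub>R\<^esub> a))"

text \<open>With denominators cleared: if \<open>c (a / s)^n\<close> lies in \<open>R\<close> for
  every \<open>n\<close>, then \<open>a / s\<close> lies in \<open>R\<close>. Such fractions are
  usually called almost integral.\<close>

definition completely_integrally_closed :: "('a, 'b) ring_scheme \<Rightarrow> bool"
  where "completely_integrally_closed R \<longleftrightarrow>
    (\<forall>a \<in> carrier R. \<forall>s \<in> nonzerodivisors R. \<forall>c \<in> nonzerodivisors R.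
      (\<forall>n::nat. \<exists>r \<in> carrier R. c \<otimes>\<^bsub>R\<^esub> a [^]\<^bsub>R\<^esub> n = r \<otimes>\<^bsub>R\<^esub> s [^]\<^bsub>R\<^esub> n)
        \<longrightarrow> (\<exists>r \<in> carrier R. a = r \<otimes>\<^bsub>R\<^esub> s))"

context cring
begin

lemma nzd_closed: "s \<in> nonzerodivisors R \<Longrightarrow> s \<in> carrier R"
  by (simp add: nonzerodivisors_def)

lemma nzd_zero: "\<lbrakk>s \<in> nonzerodivisors R; a \<in> carrier R; s \<otimes> a = \<zero>\<rbrakk> \<Longrightarrow> a = \<zero>"
  by (auto simp: nonzerodivisors_def m_comm)

lemma nzd_cancel:
  assumes "s \<in> nonzerodivisors R" "a \<in> carrier R" "b \<in> carrier R" "s \<otimes> a = s \<otimes> b"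
  shows "a = b"
proof -
  have "s \<otimes> (a \<ominus> b) = \<zero>"
    using assms nzd_closed[OF assms(1)] by (simp add: a_minus_def r_distr r_minus r_neg)
  then have "a \<ominus> b = \<zero>" using assms nzd_zero by blast
  then show ?thesis using assms by simp
qed

lemma nzdI: "\<lbrakk>s \<in> carrier R; \<And>a. \<lbrakk>a \<in> carrier R; s \<otimes> a = \<zero>\<rbrakk> \<Longrightarrow> a = \<zero>\<rbrakk> \<Longrightarrow> s \<in> nonzerodivisors R"
  by (auto simp: nonzerodivisors_def m_comm)

lemma nzd_one [simp, intro]: "\<one> \<in> nonzerodivisors R"
  by (auto simp: nonzerodivisors_def)

declare nzd_closed [simp, intro]

lemma nzd_mult [simp, intro]:
  assumes "s \<in> nonzerodivisors R" "t \<in> nonzerodivisors R"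
  shows "s \<otimes> t \<in> nonzerodivisors R"
  using assms by (intro nzdI) (auto simp: m_assoc intro: nzd_zero)

lemma nzd_pow [simp, intro]: "s \<in> nonzerodivisors R \<Longrightarrow> s [^] (n::nat) \<in> nonzerodivisors R"
  by (induction n) auto

lemma nzd_factor:
  assumes "s \<otimes> t \<in> nonzerodivisors R" "s \<in> carrier R" "t \<in> carrier R"
  shows "s \<in> nonzerodivisors R"
proof (rule nzdI)
  fix a assume a: "a \<in> carrier R" "s \<otimes> a = \<zero>"
  have "(s \<otimes> t) \<otimes> a = t \<otimes> (s \<otimes> a)" using assms(2,3) a(1) by (simp add: m_ac)
  with a(2) have "(s \<otimes> t) \<otimes> a = \<zero>" using assms by simp
  then show "a = \<zero>" using assms a nzd_zero by simp
qed (use assms in simp)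

lemma nzd_of_pow:
  assumes "s [^] Suc n \<in> nonzerodivisors R" "s \<in> carrier R"
  shows "s \<in> nonzerodivisors R"
  using assms nzd_factor[of s "s [^] n"] by (simp add: m_comm)
end

section \<open>Arithmetic of fractions with regular denominators\<close>

context cring
begin

text \<open>The class of \<open>(a, s)\<close> contains \<open>(a, s)\<close> itself, which gives
  one direction. For the other, membership in the two classes is compared after multiplication by
  \<open>s\<close> or \<open>t\<close>, which can be cancelled.\<close>

lemma fraction_eq_iff:
  assumes "a \<in> carrier R" "b \<in> carrier R" "s \<in> nonzerodivisors R" "t \<in> nonzerodivisors R"
  shows "fraction R a s = fraction R b t \<longleftrightarrow> a \<otimes> t = b \<otimes> s"
proof
  assume "fraction R a s = fraction R b t"
  moreover have "(a, s) \<in> fraction R a s" using assms by (simp add: fraction_def)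
  ultimately have "(a, s) \<in> fraction R b t" by simp
  then show "a \<otimes> t = b \<otimes> s" by (simp add: fraction_def)
next
  assume eq: "a \<otimes> t = b \<otimes> s"
  have "a \<otimes> u = c \<otimes> s \<longleftrightarrow> b \<otimes> u = c \<otimes> t" if "c \<in> carrier R" "u \<in> nonzerodivisors R" for c u
  proof
    assume "a \<otimes> u = c \<otimes> s"
    have "s \<otimes> (b \<otimes> u) = (b \<otimes> s) \<otimes> u" using assms that by (simp add: m_ac)
    also have "\<dots> = t \<otimes> (a \<otimes> u)" unfolding eq[symmetric] using assms that by (simp add: m_ac)
    also have "\<dots> = s \<otimes> (c \<otimes> t)" unfolding \<open>a \<otimes> u = c \<otimes> s\<close> using assms that by (simp add: m_ac)
    finally show "b \<otimes> u = c \<otimes> t" using nzd_cancel[OF assms(3)] assms that by simp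
  next
    assume "b \<otimes> u = c \<otimes> t"
    have "t \<otimes> (a \<otimes> u) = (a \<otimes> t) \<otimes> u" using assms that by (simp add: m_ac)
    also have "\<dots> = s \<otimes> (b \<otimes> u)" unfolding eq using assms that by (simp add: m_ac)
    also have "\<dots> = t \<otimes> (c \<otimes> s)" unfolding \<open>b \<otimes> u = c \<otimes> t\<close> using assms that by (simp add: m_ac)
    finally show "a \<otimes> u = c \<otimes> s" using nzd_cancel[OF assms(4)] assms that by simp
  qed
  then show "fraction R a s = fraction R b t" by (auto simp: fraction_def)
qed

lemma fraction_self: "\<lbrakk>a \<in> carrier R; s \<in> nonzerodivisors R\<rbrakk> \<Longrightarrow> (a, s) \<in> fraction R a s"
  by (simp add: fraction_def)

lemma tqr_carrier: "carrier (total_quotient_ring R) =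
    {fraction R a s | a s. a \<in> carrier R \<and> s \<in> nonzerodivisors R}"
  by (simp add: total_quotient_ring_def)

lemma tqr_closed [simp, intro]:
  "\<lbrakk>a \<in> carrier R; s \<in> nonzerodivisors R\<rbrakk> \<Longrightarrow> fraction R a s \<in> carrier (total_quotient_ring R)"
  by (auto simp: tqr_carrier)

lemma tqr_cases:
  assumes "x \<in> carrier (total_quotient_ring R)"
  obtains a s where "a \<in> carrier R" "s \<in> nonzerodivisors R" "x = fraction R a s"
  using assms by (auto simp: tqr_carrier)

lemma tqr_mult:
  assumes "a \<in> carrier R" "b \<in> carrier R" "s \<in> nonzerodivisors R" "t \<in> nonzerodivisors R"
  shows "fraction R a s \<otimes>\<^bsub>total_quotient_ring R\<^esub> fraction R b t = fraction R (a \<otimes> b) (s \<otimes> t)"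
proof -
  have eq: "fraction R (a' \<otimes> b') (s' \<otimes> t') = fraction R (a \<otimes> b) (s \<otimes> t)"
    if h: "(a', s') \<in> fraction R a s" "(b', t') \<in> fraction R b t" for a' s' b' t'
  proof -
    have c: "a' \<in> carrier R" "s' \<in> nonzerodivisors R" "b' \<in> carrier R" "t' \<in> nonzerodivisors R"
      and e: "a \<otimes> s' = a' \<otimes> s" "b \<otimes> t' = b' \<otimes> t" using h by (auto simp: fraction_def)
    have "(a' \<otimes> b') \<otimes> (s \<otimes> t) = (a' \<otimes> s) \<otimes> (b' \<otimes> t)" using assms c by (simp add: m_ac)
    also have "\<dots> = (a \<otimes> b) \<otimes> (s' \<otimes> t')" unfolding e[symmetric] using assms c by (simp add: m_ac)
    finally show ?thesis using assms c by (subst fraction_eq_iff) auto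
  qed
  have "fraction R a s \<otimes>\<^bsub>total_quotient_ring R\<^esub> fraction R b t =
    \<Union>{fraction R (a' \<otimes> b') (s' \<otimes> t') | a' s' b' t'. (a', s') \<in> fraction R a s \<and> (b', t') \<in> fraction R b t}"
    by (simp add: total_quotient_ring_def)
  also have "{fraction R (a' \<otimes> b') (s' \<otimes> t') | a' s' b' t'. (a', s') \<in> fraction R a s \<and> (b', t') \<in> fraction R b t}
    = {fraction R (a \<otimes> b) (s \<otimes> t)}"
    using eq fraction_self[OF assms(1,3)] fraction_self[OF assms(2,4)] by blast
  finally show ?thesis by simp
qed

lemma tqr_add:
  assumes "a \<in> carrier R" "b \<in> carrier R" "s \<in> nonzerodivisors R" "t \<in> nonzerodivisors R"
  shows "fraction R a s \<oplus>\<^bsub>total_quotient_ring R\<^esub> fraction R b t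
    = fraction R (a \<otimes> t \<oplus> b \<otimes> s) (s \<otimes> t)"
proof -
  have eq: "fraction R (a' \<otimes> t' \<oplus> b' \<otimes> s') (s' \<otimes> t') = fraction R (a \<otimes> t \<oplus> b \<otimes> s) (s \<otimes> t)"
    if h: "(a', s') \<in> fraction R a s" "(b', t') \<in> fraction R b t" for a' s' b' t'
  proof -
    have c: "a' \<in> carrier R" "s' \<in> nonzerodivisors R" "b' \<in> carrier R" "t' \<in> nonzerodivisors R"
      and e: "a \<otimes> s' = a' \<otimes> s" "b \<otimes> t' = b' \<otimes> t" using h by (auto simp: fraction_def)
    have "(a' \<otimes> t' \<oplus> b' \<otimes> s') \<otimes> (s \<otimes> t)
        = (a' \<otimes> s) \<otimes> (t \<otimes> t') \<oplus> (b' \<otimes> t) \<otimes> (s \<otimes> s')"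
      using assms c by (simp add: m_ac l_distr r_distr)
    also have "\<dots> = (a \<otimes> t \<oplus> b \<otimes> s) \<otimes> (s' \<otimes> t')"
      unfolding e[symmetric] using assms c by (simp add: m_ac l_distr r_distr)
    finally show ?thesis using assms c by (subst fraction_eq_iff) auto
  qed
  have "fraction R a s \<oplus>\<^bsub>total_quotient_ring R\<^esub> fraction R b t =
    \<Union>{fraction R (a' \<otimes> t' \<oplus> b' \<otimes> s') (s' \<otimes> t') | a' s' b' t'.
      (a', s') \<in> fraction R a s \<and> (b', t') \<in> fraction R b t}"
    by (simp add: total_quotient_ring_def)
  also have "{fraction R (a' \<otimes> t' \<oplus> b' \<otimes> s') (s' \<otimes> t') | a' s' b' t'.
      (a', s') \<in> fraction R a s \<and> (b', t') \<in> fraction R b t}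
    = {fraction R (a \<otimes> t \<oplus> b \<otimes> s) (s \<otimes> t)}"
    using eq fraction_self[OF assms(1,3)] fraction_self[OF assms(2,4)] by blast
  finally show ?thesis by simp
qed

lemma tqr_one: "\<one>\<^bsub>total_quotient_ring R\<^esub> = fraction R \<one> \<one>"
  and tqr_zero: "\<zero>\<^bsub>total_quotient_ring R\<^esub> = fraction R \<zero> \<one>"
  by (simp_all add: total_quotient_ring_def)

lemma tqr_eq_zero_iff:
  assumes "a \<in> carrier R" "s \<in> nonzerodivisors R"
  shows "fraction R a s = \<zero>\<^bsub>total_quotient_ring R\<^esub> \<longleftrightarrow> a = \<zero>"
  using assms by (simp add: tqr_zero fraction_eq_iff)

lemma tqr_cring: "cring (total_quotient_ring R)"
proof (intro cringI abelian_groupI comm_monoidI)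
  let ?Q = "total_quotient_ring R"
  show "\<one>\<^bsub>?Q\<^esub> \<in> carrier ?Q" "\<zero>\<^bsub>?Q\<^esub> \<in> carrier ?Q" by (auto simp: tqr_one tqr_zero)
  fix x assume "x \<in> carrier ?Q"
  then obtain a s where x: "a \<in> carrier R" "s \<in> nonzerodivisors R" "x = fraction R a s"
    by (rule tqr_cases)
  show "\<one>\<^bsub>?Q\<^esub> \<otimes>\<^bsub>?Q\<^esub> x = x" "\<zero>\<^bsub>?Q\<^esub> \<oplus>\<^bsub>?Q\<^esub> x = x"
    using x by (simp_all add: tqr_one tqr_zero tqr_mult tqr_add)
  show "\<exists>y\<in>carrier ?Q. y \<oplus>\<^bsub>?Q\<^esub> x = \<zero>\<^bsub>?Q\<^esub>"
    using x by (intro bexI[of _ "fraction R (\<ominus> a) s"])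
      (auto simp: tqr_add tqr_zero fraction_eq_iff l_minus l_neg)
  fix y assume "y \<in> carrier ?Q"
  then obtain b t where y: "b \<in> carrier R" "t \<in> nonzerodivisors R" "y = fraction R b t"
    by (rule tqr_cases)
  show "x \<oplus>\<^bsub>?Q\<^esub> y \<in> carrier ?Q" "x \<otimes>\<^bsub>?Q\<^esub> y \<in> carrier ?Q"
    using x y by (auto simp: tqr_add tqr_mult)
  show "x \<oplus>\<^bsub>?Q\<^esub> y = y \<oplus>\<^bsub>?Q\<^esub> x" "x \<otimes>\<^bsub>?Q\<^esub> y = y \<otimes>\<^bsub>?Q\<^esub> x"
    using x y by (simp_all add: tqr_add tqr_mult m_comm a_comm)
  fix z assume "z \<in> carrier ?Q"
  then obtain c u where z: "c \<in> carrier R" "u \<in> nonzerodivisors R" "z = fraction R c u"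
    by (rule tqr_cases)
  show "x \<oplus>\<^bsub>?Q\<^esub> y \<oplus>\<^bsub>?Q\<^esub> z = x \<oplus>\<^bsub>?Q\<^esub> (y \<oplus>\<^bsub>?Q\<^esub> z)"
    "x \<otimes>\<^bsub>?Q\<^esub> y \<otimes>\<^bsub>?Q\<^esub> z = x \<otimes>\<^bsub>?Q\<^esub> (y \<otimes>\<^bsub>?Q\<^esub> z)"
    using x y z by (simp_all add: tqr_add tqr_mult m_ac l_distr r_distr a_ac)
  \<comment> \<open>The two sides of distributivity come with the different denominators
    \<open>(s \<otimes> t) \<otimes> u\<close> and
    \<open>(s \<otimes> u) \<otimes> (t \<otimes> u)\<close>, so the cross-multiplied identity is
    prepared.\<close>
  have "(((a \<otimes> t) \<oplus> (b \<otimes> s)) \<otimes> c) \<otimes> ((s \<otimes> u) \<otimes> (t \<otimes> u))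
    = ((a \<otimes> c) \<otimes> (t \<otimes> u) \<oplus> (b \<otimes> c) \<otimes> (s \<otimes> u)) \<otimes> ((s \<otimes> t) \<otimes> u)"
    using x(1,2) y(1,2) z(1,2) by (simp add: m_ac l_distr r_distr)
  then show "(x \<oplus>\<^bsub>?Q\<^esub> y) \<otimes>\<^bsub>?Q\<^esub> z = x \<otimes>\<^bsub>?Q\<^esub> z \<oplus>\<^bsub>?Q\<^esub> y \<otimes>\<^bsub>?Q\<^esub> z"
    using x y z by (simp add: tqr_add tqr_mult fraction_eq_iff)
qed

lemma to_tqr_hom: "to_total_quotient R \<in> ring_hom R (total_quotient_ring R)"
  by (rule ring_hom_memI)
    (auto simp: to_total_quotient_def tqr_mult tqr_add tqr_one)

lemma fraction_mult_denominator:
  assumes "a \<in> carrier R" "s \<in> nonzerodivisors R"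
  shows "fraction R a s \<otimes>\<^bsub>total_quotient_ring R\<^esub> to_total_quotient R s = to_total_quotient R a"
  using assms by (simp add: to_total_quotient_def tqr_mult fraction_eq_iff)

lemma tqr_minus:
  assumes "a \<in> carrier R" "s \<in> nonzerodivisors R"
  shows "\<ominus>\<^bsub>total_quotient_ring R\<^esub> fraction R a s = fraction R (\<ominus> a) s"
proof -
  interpret Q: cring "total_quotient_ring R" by (rule tqr_cring)
  have "fraction R (\<ominus> a) s \<oplus>\<^bsub>total_quotient_ring R\<^esub> fraction R a s = \<zero>\<^bsub>total_quotient_ring R\<^esub>"
    using assms by (simp add: tqr_add tqr_eq_zero_iff l_minus l_neg)
  then show ?thesis using assms by (simp add: Q.minus_equality)
qed

lemma tqr_pow:
  assumes "a \<in> carrier R" "s \<in> nonzerodivisors R"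
  shows "fraction R a s [^]\<^bsub>total_quotient_ring R\<^esub> (n::nat) = fraction R (a [^] n) (s [^] n)"
proof -
  interpret Q: cring "total_quotient_ring R" by (rule tqr_cring)
  show ?thesis using assms by (induction n) (simp_all add: tqr_one tqr_mult)
qed

end

lemma (in domain) nzd_eq: "nonzerodivisors R = carrier R - {\<zero>}"
proof
  show "nonzerodivisors R \<subseteq> carrier R - {\<zero>}"
    using nzd_zero[of \<zero> \<one>] by auto
qed (auto intro: nzdI dest: integral)

lemma (in domain) tqr_field: "field (total_quotient_ring R)"
proof -
  let ?Q = "total_quotient_ring R"
  interpret Q: cring ?Q by (rule tqr_cring)
  show ?thesis
  proof (rule Q.cring_fieldI2)
    show "\<zero>\<^bsub>?Q\<^esub> \<noteq> \<one>\<^bsub>?Q\<^esub>" by (simp add: tqr_zero tqr_one fraction_eq_iff)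
    fix x assume x: "x \<in> carrier ?Q" "x \<noteq> \<zero>\<^bsub>?Q\<^esub>"
    obtain a s where a: "a \<in> carrier R" "s \<in> nonzerodivisors R" "x = fraction R a s"
      using x(1) by (rule tqr_cases)
    with x(2) have "a \<in> nonzerodivisors R" by (auto simp: nzd_eq tqr_eq_zero_iff)
    with a show "\<exists>y\<in>carrier ?Q. x \<otimes>\<^bsub>?Q\<^esub> y = \<one>\<^bsub>?Q\<^esub>"
      by (intro bexI[of _ "fraction R s a"]) (auto simp: tqr_mult tqr_one fraction_eq_iff m_comm)
  qed
qed

section \<open>Ideals of the total quotient ring and integral closure\<close>

text \<open>Multiplication by \<open>\<ominus> \<one>\<close> supplies negatives, so only sums and
  multiples have to be checked.\<close>

lemma (in cring) ideal_criterion: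
  assumes "I \<subseteq> carrier R" "\<zero> \<in> I" "\<And>x y. \<lbrakk>x \<in> I; y \<in> I\<rbrakk> \<Longrightarrow> x \<oplus> y \<in> I"
    and "\<And>r x. \<lbrakk>r \<in> carrier R; x \<in> I\<rbrakk> \<Longrightarrow> r \<otimes> x \<in> I"
  shows "ideal I R"
proof (rule idealI)
  show "subgroup I (add_monoid R)"
  proof (rule add.subgroupI)
    fix x assume "x \<in> I"
    then have "(\<ominus> \<one>) \<otimes> x \<in> I" "x \<in> carrier R" using assms by auto
    then show "\<ominus> x \<in> I" by (simp add: l_minus)
  qed (use assms in auto)
  show "x \<otimes> a \<in> I" if "a \<in> I" "x \<in> carrier R" for a x using assms that by blast
  then show "a \<otimes> x \<in> I" if "a \<in> I" "x \<in> carrier R" for a x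
    using that assms(1) m_comm by (metis subsetD)
qed (rule ring_axioms)

context noetherian_ring
begin

text \<open>The union of a non-empty chain of ideals is a member of the chain, so Zorn's lemma
  applies to an arbitrary non-empty family of ideals.\<close>

lemma maximal_element:
  assumes "F \<noteq> {}" "\<And>I. I \<in> F \<Longrightarrow> ideal I R"
  obtains M where "M \<in> F" "\<And>J. \<lbrakk>J \<in> F; M \<subseteq> J\<rbrakk> \<Longrightarrow> J = M"
proof -
  have "\<exists>M\<in>F. \<forall>J\<in>F. M \<subseteq> J \<longrightarrow> J = M"
  proof (rule subset_Zorn_nonempty[OF assms(1)])
    fix C assume C: "C \<noteq> {}" "subset.chain F C"
    then have "subset.chain {I. ideal I R} C" using assms(2) by (auto simp: subset.chain_def)
    from ideal_chain_is_trivial[OF C(1) this] C show "\<Union> C \<in> F" by (auto simp: subset.chain_def)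
  qed
  then show thesis using that by blast
qed

text \<open>A single repetition is what the later chain arguments start from, so eventual constancy
  is not stated.\<close>

lemma ascending_chain_stabilizes:
  fixes I :: "nat \<Rightarrow> 'a set"
  assumes "\<And>n. ideal (I n) R" "\<And>n. I n \<subseteq> I (Suc n)"
  obtains n where "I (Suc n) = I n"
proof -
  obtain M where M: "M \<in> range I" "\<And>J. \<lbrakk>J \<in> range I; M \<subseteq> J\<rbrakk> \<Longrightarrow> J = M"
    using maximal_element[of "range I"] assms(1) by blast
  then obtain n where n: "M = I n" by blast
  then have "I (Suc n) = I n" using M(2)[OF rangeI] assms(2) by simp
  then show thesis by (rule that)
qed

end

context cring
begin

text \<open>Extension and contraction of ideals. A fraction is its numerator times a unit of T(R),
  so the numerator of a generator of the extension of \<open>I\<close> generates it too, and an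
  ideal of T(R) is the extension of its contraction.\<close>

lemma tqr_principal_iff_generically_principal:
  "principal_ideal_ring (total_quotient_ring R) \<longleftrightarrow> generically_principal R"
proof
  let ?Q = "total_quotient_ring R" and ?i = "to_total_quotient R"
  interpret Q: cring ?Q by (rule tqr_cring)
  {
    assume pir: "principal_ideal_ring ?Q"
    show "generically_principal R"
      unfolding generically_principal_def
    proof (intro allI impI)
      fix I assume I: "ideal I R"
      interpret I: ideal I R by (rule I)
      \<comment> \<open>This is the extension \<open>I T(R)\<close>: by common denominators single
        fractions suffice, without sums of them.\<close>
      define J where "J = {fraction R a s | a s. a \<in> I \<and> s \<in> nonzerodivisors R}"
      have JI: "fraction R a s \<in> J" if "a \<in> I" "s \<in> nonzerodivisors R" for a s
        using that by (auto simp: J_def)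
      have "ideal J ?Q"
      proof (rule Q.ideal_criterion)
        show "J \<subseteq> carrier ?Q" by (auto simp: J_def)
        show "\<zero>\<^bsub>?Q\<^esub> \<in> J" using I.zero_closed nzd_one unfolding J_def tqr_zero by blast
      next
        fix x y assume "x \<in> J" "y \<in> J"
        then obtain a s b t where "a \<in> I" "s \<in> nonzerodivisors R" "x = fraction R a s"
          "b \<in> I" "t \<in> nonzerodivisors R" "y = fraction R b t"
          by (auto simp: J_def)
        then show "x \<oplus>\<^bsub>?Q\<^esub> y \<in> J"
          by (auto simp: tqr_add intro!: JI I.a_closed I.I_r_closed)
      next
        fix x y assume "x \<in> carrier ?Q" "y \<in> J"
        then obtain a s b t where "a \<in> carrier R" "s \<in> nonzerodivisors R" "x = fraction R a s"
          "b \<in> I" "t \<in> nonzerodivisors R" "y = fraction R b t"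
          by (auto simp: J_def elim: tqr_cases)
        then show "x \<otimes>\<^bsub>?Q\<^esub> y \<in> J"
          by (auto simp: tqr_mult intro!: JI I.I_l_closed)
      qed
      then obtain z where z: "z \<in> carrier ?Q" "J = PIdl\<^bsub>?Q\<^esub> z"
        using principal_ideal_ring.all_ideals_principal[OF pir] Q.cgenideal_eq_genideal
        by (metis principalideal.generate)
      then have "z \<in> J" using Q.cgenideal_self by simp
      then obtain a s where a: "a \<in> I" "s \<in> nonzerodivisors R" "z = fraction R a s"
        by (auto simp: J_def)
      show "\<exists>a\<in>I. \<forall>x\<in>I. \<exists>s\<in>nonzerodivisors R. \<exists>r\<in>carrier R. s \<otimes> x = r \<otimes> a"
      proof (intro bexI[OF _ a(1)] ballI)
        fix x assume x: "x \<in> I"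
        then have "?i x \<in> J" by (auto simp: J_def to_total_quotient_def)
        then obtain y where y: "y \<in> carrier ?Q" "?i x = y \<otimes>\<^bsub>?Q\<^esub> z"
          using z by (auto simp: cgenideal_def)
        obtain r t where r: "r \<in> carrier R" "t \<in> nonzerodivisors R" "y = fraction R r t"
          using y(1) by (rule tqr_cases)
        have "(t \<otimes> s) \<otimes> x = r \<otimes> a"
          using y(2) r a x by (simp add: tqr_mult to_total_quotient_def fraction_eq_iff m_comm)
        with r a show "\<exists>s\<in>nonzerodivisors R. \<exists>r\<in>carrier R. s \<otimes> x = r \<otimes> a"
          by (intro bexI[of _ "t \<otimes> s"] bexI[of _ r]) auto
      qed
    qed
  }
  assume gp: "generically_principal R"
  show "principal_ideal_ring ?Q"
  proof (intro principal_ideal_ring.intro principal_ideal_ring_axioms.intro tqr_cring)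
    fix J assume J: "ideal J ?Q"
    interpret J: ideal J ?Q by (rule J)
    define I where "I = {a \<in> carrier R. ?i a \<in> J}"
    have "ideal I R"
    proof (rule ideal_criterion)
      show "\<zero> \<in> I" using J.zero_closed by (simp add: I_def to_total_quotient_def tqr_zero)
      show "x \<oplus> y \<in> I" if "x \<in> I" "y \<in> I" for x y
        using that ring_hom_add[OF to_tqr_hom, of x y] by (simp add: I_def)
      show "r \<otimes> x \<in> I" if "r \<in> carrier R" "x \<in> I" for r x
        using that ring_hom_mult[OF to_tqr_hom, of r x] ring_hom_closed[OF to_tqr_hom, of r]
          J.I_l_closed by (simp add: I_def)
    qed (auto simp: I_def)
    with gp obtain a where a: "a \<in> I"
      "\<And>x. x \<in> I \<Longrightarrow> \<exists>s \<in> nonzerodivisors R. \<exists>r \<in> carrier R. s \<otimes> x = r \<otimes> a"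
      unfolding generically_principal_def by metis
    have ia: "a \<in> carrier R" "?i a \<in> J" "?i a \<in> carrier ?Q"
      using a(1) J.Icarr by (auto simp: I_def)
    have "J \<subseteq> PIdl\<^bsub>?Q\<^esub> (?i a)"
    proof
      fix y assume y: "y \<in> J"
      obtain x t where x: "x \<in> carrier R" "t \<in> nonzerodivisors R" "y = fraction R x t"
        using J.Icarr[OF y] by (rule tqr_cases)
      have "?i t \<in> carrier ?Q" using x by (simp add: to_total_quotient_def)
      with J.I_r_closed[OF y] have "y \<otimes>\<^bsub>?Q\<^esub> ?i t \<in> J" by simp
      then have "x \<in> I" using x fraction_mult_denominator by (simp add: I_def)
      then obtain s r where s: "s \<in> nonzerodivisors R" "r \<in> carrier R" "s \<otimes> x = r \<otimes> a"
        using a(2) by blast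
      have "x \<otimes> (s \<otimes> t) = t \<otimes> (s \<otimes> x)" using x s(1,2) by (simp add: m_ac)
      also have "\<dots> = (r \<otimes> a) \<otimes> t" unfolding s(3) using x s(1,2) ia by (simp add: m_ac)
      finally have "y = fraction R r (s \<otimes> t) \<otimes>\<^bsub>?Q\<^esub> ?i a"
        using x s(1,2) ia by (simp add: to_total_quotient_def tqr_mult fraction_eq_iff)
      then show "y \<in> PIdl\<^bsub>?Q\<^esub> (?i a)"
        unfolding cgenideal_def using x s by blast
    qed
    then have "J = PIdl\<^bsub>?Q\<^esub> (?i a)" using Q.cgenideal_minimal[OF J] ia by blast
    then show "principalideal J ?Q"
      using J ia by (intro principalidealI) (auto simp: Q.cgenideal_eq_genideal)
  qed
qed

end

section \<open>From integral to complete integral closedness\<close>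

context cring
begin

text \<open>Coefficient lists of a fixed length may start with zeros, so they are added position by
  position and not as normalised polynomials.\<close>

lemma eval_map2_add:
  assumes "length p = length q" "set p \<subseteq> carrier R" "set q \<subseteq> carrier R" "x \<in> carrier R"
  shows "eval (map2 (\<oplus>) p q) x = eval p x \<oplus> eval q x"
  using assms
proof (induction p q rule: list_induct2)
  case (Cons a p b q)
  then show ?case
    using eval_in_carrier[of p x] eval_in_carrier[of q x] by (simp add: l_distr a_ac)
qed simp

lemma eval_map_mult:
  assumes "k \<in> carrier R" "set p \<subseteq> carrier R" "x \<in> carrier R"
  shows "eval (map ((\<otimes>) k) p) x = k \<otimes> eval p x"
  using assms(2)
  by (induction p) (use assms eval_in_carrier in \<open>auto simp: r_distr m_assoc\<close>)

text \<open>For \<open>x = a / s\<close> all \<open>c x^n\<close> lie in \<open>R\<close>, so the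
  spans of \<open>c, c x, ..., c x^(n-1)\<close> form an ascending chain of ideals of
  \<open>R\<close>. Where it repeats, \<open>c x^n = c p(x)\<close> with \<open>p\<close> of degree
  below \<open>n\<close>, and cancelling \<open>c\<close> leaves an integral equation for
  \<open>x\<close>.\<close>

lemma integrally_closed_imp_completely_integrally_closed:
  assumes "noetherian_ring R" "integrally_closed R" "\<one> \<noteq> \<zero>"
  shows "completely_integrally_closed R"
  unfolding completely_integrally_closed_def
proof (intro ballI impI)
  let ?Q = "total_quotient_ring R" and ?i = "to_total_quotient R"
  interpret Q: cring ?Q by (rule tqr_cring)
  note hom = to_tqr_hom
  fix a s c
  assume a: "a \<in> carrier R" and s: "s \<in> nonzerodivisors R" and c: "c \<in> nonzerodivisors R"
    and "\<forall>n::nat. \<exists>r\<in>carrier R. c \<otimes> a [^] n = r \<otimes> s [^] n"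
  then obtain r where r: "\<And>n::nat. r n \<in> carrier R" "\<And>n. c \<otimes> a [^] n = r n \<otimes> s [^] n"
    by metis
  define x where "x = fraction R a s"
  have x: "x \<in> carrier ?Q" using a s by (simp add: x_def)
  define A where "A = ?i ` carrier R"
  have A: "A \<subseteq> carrier ?Q" using ring_hom_closed[OF hom] by (auto simp: A_def)
  have ic: "?i c \<in> carrier ?Q" using c ring_hom_closed[OF hom] by simp
  have A0: "\<zero>\<^bsub>?Q\<^esub> \<in> A" "\<one>\<^bsub>?Q\<^esub> \<in> A" "\<ominus>\<^bsub>?Q\<^esub> \<one>\<^bsub>?Q\<^esub> \<in> A"
    unfolding A_def
    by (auto simp: tqr_one tqr_zero to_total_quotient_def tqr_minus)
  have i0: "?i \<zero> = \<zero>\<^bsub>?Q\<^esub>" by (simp add: to_total_quotient_def tqr_zero)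
  have Aadd: "y \<oplus>\<^bsub>?Q\<^esub> z \<in> A" if "y \<in> A" "z \<in> A" for y z
    using that ring_hom_add[OF hom] unfolding A_def by (smt (verit) a_closed image_iff)
  have Amult: "y \<otimes>\<^bsub>?Q\<^esub> z \<in> A" if "y \<in> A" "z \<in> A" for y z
    using that ring_hom_mult[OF hom] unfolding A_def by (smt (verit) m_closed image_iff)
  have rx: "?i (r n) = ?i c \<otimes>\<^bsub>?Q\<^esub> x [^]\<^bsub>?Q\<^esub> n" for n
    using a s c r[of n] by (simp add: x_def to_total_quotient_def tqr_pow tqr_mult fraction_eq_iff)
  \<comment> \<open>Lists of length \<open>n\<close> stand for the polynomials of degree below
    \<open>n\<close>. The span is taken inside \<open>R\<close>, where the chain condition is
    available.\<close>
  define J where "J n = {z \<in> carrier R. \<exists>p. set p \<subseteq> A \<and> length p = n \<and>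
      ?i z = ?i c \<otimes>\<^bsub>?Q\<^esub> Q.eval p x}" for n
  have "ideal (J n) R" for n
  proof (rule ideal_criterion)
    have "Q.eval (replicate n \<zero>\<^bsub>?Q\<^esub>) x = \<zero>\<^bsub>?Q\<^esub>"
      using Q.eval_replicate[of "[]" x n] x by simp
    then show "\<zero> \<in> J n"
      using A0 ic i0 unfolding J_def
      by (intro CollectI conjI exI[of _ "replicate n \<zero>\<^bsub>?Q\<^esub>"]) auto
  next
    fix y z assume "y \<in> J n" "z \<in> J n"
    then obtain p q where p: "y \<in> carrier R" "set p \<subseteq> A" "length p = n"
        "?i y = ?i c \<otimes>\<^bsub>?Q\<^esub> Q.eval p x"
      and q: "z \<in> carrier R" "set q \<subseteq> A" "length q = n" "?i z = ?i c \<otimes>\<^bsub>?Q\<^esub> Q.eval q x"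
      by (auto simp: J_def)
    have "set p \<subseteq> carrier ?Q" "set q \<subseteq> carrier ?Q" using p q A by auto
    then have "?i (y \<oplus> z) = ?i c \<otimes>\<^bsub>?Q\<^esub> Q.eval (map2 (\<oplus>\<^bsub>?Q\<^esub>) p q) x"
      using p q x ic ring_hom_add[OF hom] Q.eval_in_carrier
      by (simp add: Q.eval_map2_add Q.r_distr)
    moreover have "set (map2 (\<oplus>\<^bsub>?Q\<^esub>) p q) \<subseteq> A"
      using p(2) q(2) by (auto simp: set_zip in_set_zip intro!: Aadd)
    ultimately show "y \<oplus> z \<in> J n"
      using p q by (auto simp: J_def intro!: exI[of _ "map2 (\<oplus>\<^bsub>?Q\<^esub>) p q"])
  next
    fix k y assume k: "k \<in> carrier R" "y \<in> J n"
    then obtain p where p: "y \<in> carrier R" "set p \<subseteq> A" "length p = n"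
        "?i y = ?i c \<otimes>\<^bsub>?Q\<^esub> Q.eval p x"
      by (auto simp: J_def)
    have ik: "?i k \<in> A" "?i k \<in> carrier ?Q" using k ring_hom_closed[OF hom] by (auto simp: A_def)
    have "set p \<subseteq> carrier ?Q" using p A by auto
    then have "?i (k \<otimes> y) = ?i c \<otimes>\<^bsub>?Q\<^esub> Q.eval (map ((\<otimes>\<^bsub>?Q\<^esub>) (?i k)) p) x"
      using p x ic ik k ring_hom_mult[OF hom] Q.eval_in_carrier
      by (simp add: Q.eval_map_mult Q.m_lcomm)
    moreover have "set (map ((\<otimes>\<^bsub>?Q\<^esub>) (?i k)) p) \<subseteq> A"
      using p(2) ik by (auto intro!: Amult)
    ultimately show "k \<otimes> y \<in> J n"
      using p k unfolding J_def
      by (intro CollectI conjI exI[of _ "map ((\<otimes>\<^bsub>?Q\<^esub>) (?i k)) p"]) auto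
  qed (auto simp: J_def)
  moreover have "J n \<subseteq> J (Suc n)" for n
  proof
    fix z assume "z \<in> J n"
    then obtain p where p: "z \<in> carrier R" "set p \<subseteq> A" "length p = n"
        "?i z = ?i c \<otimes>\<^bsub>?Q\<^esub> Q.eval p x"
      by (auto simp: J_def)
    moreover have "set p \<subseteq> carrier ?Q" using p A by auto
    ultimately show "z \<in> J (Suc n)"
      using A0 x ic Q.eval_in_carrier by (auto simp: J_def intro!: exI[of _ "\<zero>\<^bsub>?Q\<^esub> # p"])
  qed
  ultimately obtain n where n: "J (Suc n) = J n"
    using noetherian_ring.ascending_chain_stabilizes[OF assms(1)] by blast
  have "r n \<in> J (Suc n)"
    using r A0 rx[of n] Q.eval_monom[of "\<one>\<^bsub>?Q\<^esub>" x n] x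
    by (auto simp: J_def Q.monom_def intro!: exI[of _ "Q.monom \<one>\<^bsub>?Q\<^esub> n"])
  then obtain p where p: "set p \<subseteq> A" "length p = n" "?i (r n) = ?i c \<otimes>\<^bsub>?Q\<^esub> Q.eval p x"
    unfolding n by (auto simp: J_def)
  have pc: "set p \<subseteq> carrier ?Q" "Q.eval p x \<in> carrier ?Q" using p A x Q.eval_in_carrier by blast+
  \<comment> \<open>\<open>c\<close> becomes invertible in T(R), which allows the
    cancellation.\<close>
  have "fraction R \<one> c \<otimes>\<^bsub>?Q\<^esub> ?i c = \<one>\<^bsub>?Q\<^esub>"
    using fraction_mult_denominator[of \<one> c] c by (simp add: to_total_quotient_def tqr_one)
  moreover have "fraction R \<one> c \<otimes>\<^bsub>?Q\<^esub> (?i c \<otimes>\<^bsub>?Q\<^esub> x [^]\<^bsub>?Q\<^esub> n)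
      = fraction R \<one> c \<otimes>\<^bsub>?Q\<^esub> (?i c \<otimes>\<^bsub>?Q\<^esub> Q.eval p x)"
    using rx[of n] p by simp
  ultimately have xn: "x [^]\<^bsub>?Q\<^esub> n = Q.eval p x"
    using c ic x pc by (simp add: Q.m_assoc[symmetric])
  \<comment> \<open>The monic polynomial \<open>X^n - p\<close>: as \<open>p\<close> has exactly
    \<open>n\<close> entries, the prepended \<open>\<one>\<close> is the coefficient of
    \<open>X^n\<close>.\<close>
  define q where "q = \<one>\<^bsub>?Q\<^esub> # map ((\<otimes>\<^bsub>?Q\<^esub>) (\<ominus>\<^bsub>?Q\<^esub> \<one>\<^bsub>?Q\<^esub>)) p"
  have "Q.eval q x = \<zero>\<^bsub>?Q\<^esub>"
    using pc x p(2) xn by (simp add: q_def Q.eval_map_mult Q.l_minus Q.r_neg)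
  moreover have "set q \<subseteq> A" using p(1) A0 Amult by (auto simp: q_def)
  moreover have "\<one>\<^bsub>?Q\<^esub> \<noteq> \<zero>\<^bsub>?Q\<^esub>" using assms(3) by (simp add: tqr_eq_zero_iff tqr_one)
  ultimately have "integral_over ?Q A x"
    unfolding integral_over_def
    by (intro bexI[of _ q]) (auto simp: q_def univ_poly_carrier[symmetric] polynomial_def)
  then have "x \<in> A" using assms(2) x by (simp add: integrally_closed_def A_def)
  then obtain k where "k \<in> carrier R" "x = ?i k" by (auto simp: A_def)
  then show "\<exists>r\<in>carrier R. a = r \<otimes> s"
    using a s by (auto simp: x_def to_total_quotient_def fraction_eq_iff)
qed

end

section \<open>Special primary rings and direct products\<close>

lemma (in cring) geometric_sum:
  assumes "m \<in> carrier R"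
  shows "\<exists>k \<in> carrier R. k \<otimes> (\<one> \<ominus> m) = \<one> \<ominus> m [^] (n::nat)"
proof (induction n)
  case 0
  show ?case using assms by (intro bexI[of _ \<zero>]) (simp_all add: a_minus_def r_neg)
next
  case (Suc n)
  then obtain k where k: "k \<in> carrier R" "k \<otimes> (\<one> \<ominus> m) = \<one> \<ominus> m [^] n" by blast
  have "(k \<oplus> m [^] n) \<otimes> (\<one> \<ominus> m) = (\<one> \<ominus> m [^] n) \<oplus> m [^] n \<otimes> (\<one> \<ominus> m)"
    using k(1) assms by (simp add: l_distr k(2))
  also have "\<dots> = \<one> \<ominus> m [^] Suc n"
  proof -
    have "m [^] n \<in> carrier R" using assms by simp
    then show ?thesis using assms
      by (simp add: a_minus_def r_distr r_minus a_assoc) (simp add: a_assoc[symmetric] l_neg)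
  qed
  finally show ?case using k assms by (intro bexI[of _ "k \<oplus> m [^] n"]) auto
qed

lemma (in cring) one_minus_nilpotent_unit:
  assumes "m \<in> carrier R" "m [^] (n::nat) = \<zero>"
  shows "\<exists>k \<in> carrier R. k \<otimes> (\<one> \<ominus> m) = \<one>"
  using geometric_sum[OF assms(1), of n] assms(2) by (simp add: a_minus_def)

text \<open>In a non-zero ideal any non-zero \<open>a\<close> will do: it is regular, and
  \<open>a x = x a\<close> lets it serve as the multiplier \<open>s\<close> as well.\<close>

lemma (in domain) domain_generically_principal: "generically_principal R"
  unfolding generically_principal_def
proof (intro allI impI)
  fix I assume "ideal I R"
  then interpret I: ideal I R .
  show "\<exists>a\<in>I. \<forall>x\<in>I. \<exists>s\<in>nonzerodivisors R. \<exists>r\<in>carrier R. s \<otimes> x = r \<otimes> a"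
  proof (cases "I = {\<zero>}")
    case True
    then show ?thesis using nzd_one zero_closed r_null l_null by (metis nzd_closed singletonD singletonI)
  next
    case False
    then obtain a where a: "a \<in> I" "a \<noteq> \<zero>" using I.zero_closed by blast
    then have "a \<in> nonzerodivisors R" using I.Icarr by (simp add: nzd_eq)
    with a show ?thesis using I.Icarr m_comm by (intro bexI[of _ a]) blast+
  qed
qed

context special_primary_ring
begin

text \<open>For \<open>x\<close> outside the maximal ideal, \<open>1 = m + r x\<close> with
  \<open>m\<close> nilpotent, so \<open>r x = 1 - m\<close> is a unit and hence \<open>x\<close> is
  one.\<close>

lemma maximal_ideal_structure:
  obtains p n where "p \<in> carrier R" "p [^] (n::nat) = \<zero>"
    "\<And>x. x \<in> carrier R \<Longrightarrow> (\<exists>r \<in> carrier R. x = r \<otimes> p) \<or> (\<exists>y \<in> carrier R. y \<otimes> x = \<one>)"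
proof -
  obtain M n where M: "maximalideal M R" "principalideal M R" "M [^]\<^bsub>ideals_set R\<^esub> (n::nat) = {\<zero>}"
    using local_nilpotent_principal by blast
  interpret M: maximalideal M R by (rule M)
  interpret S: comm_monoid "ideals_set R" by (rule ideals_set_is_comm_monoid)
  \<comment> \<open>Powers of elements lie in powers of the ideal, so \<open>M^n = 0\<close> makes
    every element of \<open>M\<close> nilpotent.\<close>
  have "x [^] k \<in> M [^]\<^bsub>ideals_set R\<^esub> k" if "x \<in> M" for x and k :: nat
  proof (induction k)
    case 0
    show ?case by (simp add: ideals_set_def)
  next
    case (Suc k)
    then show ?case using that by (auto simp: ideals_set_def intro: ideal_prod.prod)
  qed
  then have nil: "x [^] n = \<zero>" if "x \<in> M" for x using M(3) that by blast
  obtain p where p: "p \<in> carrier R" "M = PIdl p"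
    using principalideal.generate[OF M(2)] cgenideal_eq_genideal by auto
  have "\<exists>y \<in> carrier R. y \<otimes> x = \<one>" if x: "x \<in> carrier R" "x \<notin> M" for x
  proof -
    have id: "ideal (M <+> PIdl x) R"
      using add_ideals[OF M.is_ideal cgenideal_ideal[OF x(1)]] .
    have Z: "\<zero> \<in> PIdl x" "x \<in> PIdl x"
      using cgenideal_self[OF x(1)] additive_subgroup.zero_closed[OF ideal.axioms(1)[OF cgenideal_ideal[OF x(1)]]]
      by auto
    have "M \<subseteq> M <+> PIdl x"
    proof
      fix m assume "m \<in> M"
      moreover from this have "m = m \<oplus> \<zero>" using M.Icarr by simp
      ultimately show "m \<in> M <+> PIdl x" using Z(1) unfolding set_add_def' by blast
    qed
    moreover have "x \<in> M <+> PIdl x"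
    proof -
      have "x = \<zero> \<oplus> x" using x by simp
      then show ?thesis using Z(2) M.zero_closed unfolding set_add_def' by blast
    qed
    moreover have "M <+> PIdl x \<subseteq> carrier R" using ideal.Icarr[OF id] by blast
    ultimately have "M <+> PIdl x = carrier R" using M.I_maximal[OF id] x(2) by blast
    then have "\<one> \<in> M <+> PIdl x" by simp
    then obtain m r where m: "m \<in> M" "r \<in> carrier R" "\<one> = m \<oplus> r \<otimes> x"
      unfolding set_add_def' cgenideal_def by auto
    then have mc: "m \<in> carrier R" using M.Icarr by blast
    have "\<one> \<ominus> m = r \<otimes> x"
      using m(2) x(1) mc by (simp add: m(3) a_minus_def a_comm[of m] a_assoc r_neg)
    moreover obtain k where "k \<in> carrier R" "k \<otimes> (\<one> \<ominus> m) = \<one>"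
      using one_minus_nilpotent_unit[OF mc nil[OF m(1)]] by blast
    ultimately show ?thesis using m(2) x(1) by (intro bexI[of _ "k \<otimes> r"]) (auto simp: m_assoc)
  qed
  moreover have "\<exists>r \<in> carrier R. x = r \<otimes> p" if "x \<in> M" for x
    using that unfolding p(2) cgenideal_def by blast
  ultimately have "(\<exists>r \<in> carrier R. x = r \<otimes> p) \<or> (\<exists>y \<in> carrier R. y \<otimes> x = \<one>)"
    if "x \<in> carrier R" for x
    using that by (cases "x \<in> M") simp_all
  moreover have "p [^] n = \<zero>" using nil p cgenideal_self by blast
  ultimately show thesis using p(1) that[of p n] by simp
qed

text \<open>Every non-zero element is a unit times a power of \<open>p\<close>, so an ideal is
  generated by the lowest power of \<open>p\<close> that it contains.\<close>

lemma special_primary_generically_principal: "generically_principal R"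
  unfolding generically_principal_def
proof (intro allI impI)
  fix I assume "ideal I R"
  then interpret I: ideal I R .
  obtain p n where p: "p \<in> carrier R" "p [^] (n::nat) = \<zero>"
    "\<And>x. x \<in> carrier R \<Longrightarrow> (\<exists>r \<in> carrier R. x = r \<otimes> p) \<or> (\<exists>y \<in> carrier R. y \<otimes> x = \<one>)"
    using maximal_ideal_structure by blast
  \<comment> \<open>Factors \<open>p\<close> are split off until a unit remains or \<open>m\<close>
    of them have been found; for \<open>m = n\<close> the latter means
    \<open>x = \<zero>\<close>.\<close>
  have fact: "\<exists>i \<le> m. \<exists>r \<in> carrier R. x = r \<otimes> p [^] i \<and> (i = m \<or> (\<exists>y \<in> carrier R. y \<otimes> r = \<one>))"
    if x: "x \<in> carrier R" for x and m :: nat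
  proof (induction m)
    case 0
    show ?case using x by auto
  next
    case (Suc m)
    then obtain i r where i: "i \<le> m" "r \<in> carrier R" "x = r \<otimes> p [^] i"
      "i = m \<or> (\<exists>y \<in> carrier R. y \<otimes> r = \<one>)" by blast
    show ?case
    proof (cases "\<exists>y \<in> carrier R. y \<otimes> r = \<one>")
      case True
      with i show ?thesis by (metis le_SucI)
    next
      case False
      with p(3) i obtain q where q: "q \<in> carrier R" "r = q \<otimes> p" by blast
      have "x = q \<otimes> p [^] Suc m" using i(3,4) False q p(1) by (auto simp: m_ac)
      with q show ?thesis by blast
    qed
  qed
  define j where "j = (LEAST j. p [^] (j::nat) \<in> I)"
  have n: "p [^] n \<in> I" using p(2) I.zero_closed by simp
  then have j: "p [^] j \<in> I" "j \<le> n" unfolding j_def by (auto intro: LeastI Least_le)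
  show "\<exists>a\<in>I. \<forall>x\<in>I. \<exists>s\<in>nonzerodivisors R. \<exists>r\<in>carrier R. s \<otimes> x = r \<otimes> a"
  proof (intro bexI[OF _ j(1)] ballI)
    fix x assume x: "x \<in> I"
    then obtain i r where i: "i \<le> n" "r \<in> carrier R" "x = r \<otimes> p [^] i"
      "i = n \<or> (\<exists>y \<in> carrier R. y \<otimes> r = \<one>)"
      using fact[of x n] I.Icarr by blast
    \<comment> \<open>If \<open>i < j \<le> n\<close>, then \<open>r\<close> is a unit and
      \<open>I\<close> would contain the smaller power \<open>p [^] i\<close>.\<close>
    have "j \<le> i"
    proof (rule ccontr)
      assume "\<not> j \<le> i"
      then obtain y where y: "y \<in> carrier R" "y \<otimes> r = \<one>" using i j by auto
      have "y \<otimes> x = p [^] i" using y i p(1) by (simp add: m_assoc[symmetric])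
      then have "p [^] i \<in> I" using I.I_l_closed[OF x y(1)] by simp
      then have "j \<le> i" unfolding j_def by (rule Least_le)
      with \<open>\<not> j \<le> i\<close> show False by simp
    qed
    then have "p [^] i = p [^] (i - j) \<otimes> p [^] j" using p(1) by (simp add: nat_pow_mult)
    then have "\<one> \<otimes> x = (r \<otimes> p [^] (i - j)) \<otimes> p [^] j"
      using i p(1) by (simp add: m_assoc)
    then show "\<exists>s\<in>nonzerodivisors R. \<exists>r\<in>carrier R. s \<otimes> x = r \<otimes> p [^] j"
      using i p(1) nzd_one by (metis m_closed nat_pow_closed)
  qed
qed

end

section \<open>Direct products and isomorphic copies\<close>

lemma RDirProd_simps [simp]:
  "carrier (RDirProd R S) = carrier R \<times> carrier S"
  "(a, b) \<otimes>\<^bsub>RDirProd R S\<^esub> (c, d) = (a \<otimes>\<^bsub>R\<^esub> c, b \<otimes>\<^bsub>S\<^esub> d)"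
  "(a, b) \<oplus>\<^bsub>RDirProd R S\<^esub> (c, d) = (a \<oplus>\<^bsub>R\<^esub> c, b \<oplus>\<^bsub>S\<^esub> d)"
  "\<one>\<^bsub>RDirProd R S\<^esub> = (\<one>\<^bsub>R\<^esub>, \<one>\<^bsub>S\<^esub>)"
  "\<zero>\<^bsub>RDirProd R S\<^esub> = (\<zero>\<^bsub>R\<^esub>, \<zero>\<^bsub>S\<^esub>)"
  by (auto simp: RDirProd_def DirProd_def monoid.defs)

lemma RDirProd_cring:
  assumes "cring R" "cring S"
  shows "cring (RDirProd R S)"
proof -
  interpret R: cring R by fact
  interpret S: cring S by fact
  interpret P: ring "RDirProd R S" using RDirProd_ring[OF R.ring_axioms S.ring_axioms] .
  show ?thesis by unfold_locales (auto simp: R.m_comm S.m_comm)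
qed

text \<open>An ideal of the product is the product of its slices \<open>A\<close> and
  \<open>B\<close>, since multiplication by (1, 0) and (0, 1) separates the components. Generators
  and regular multipliers are then paired.\<close>

lemma RDirProd_generically_principal:
  assumes "cring R" "cring S" "generically_principal R" "generically_principal S"
  shows "generically_principal (RDirProd R S)"
  unfolding generically_principal_def
proof (intro allI impI)
  interpret R: cring R by fact
  interpret S: cring S by fact
  let ?P = "RDirProd R S"
  interpret P: cring ?P using RDirProd_cring[OF assms(1,2)] .
  fix I assume "ideal I ?P"
  then interpret I: ideal I ?P .
  define A where "A = {a \<in> carrier R. (a, \<zero>\<^bsub>S\<^esub>) \<in> I}"
  define B where "B = {b \<in> carrier S. (\<zero>\<^bsub>R\<^esub>, b) \<in> I}"
  have "ideal A R"
  proof (rule R.ideal_criterion)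
    show "x \<oplus>\<^bsub>R\<^esub> y \<in> A" if "x \<in> A" "y \<in> A" for x y
      using that I.a_closed[of "(x, \<zero>\<^bsub>S\<^esub>)" "(y, \<zero>\<^bsub>S\<^esub>)"] by (simp add: A_def)
    show "r \<otimes>\<^bsub>R\<^esub> x \<in> A" if "r \<in> carrier R" "x \<in> A" for r x
      using that I.I_l_closed[of "(x, \<zero>\<^bsub>S\<^esub>)" "(r, \<zero>\<^bsub>S\<^esub>)"] by (simp add: A_def)
  qed (use I.zero_closed in \<open>auto simp: A_def\<close>)
  then obtain a where a: "a \<in> A"
    "\<And>x. x \<in> A \<Longrightarrow> \<exists>s\<in>nonzerodivisors R. \<exists>r\<in>carrier R. s \<otimes>\<^bsub>R\<^esub> x = r \<otimes>\<^bsub>R\<^esub> a"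
    using assms(3) unfolding generically_principal_def by metis
  have "ideal B S"
  proof (rule S.ideal_criterion)
    show "x \<oplus>\<^bsub>S\<^esub> y \<in> B" if "x \<in> B" "y \<in> B" for x y
      using that I.a_closed[of "(\<zero>\<^bsub>R\<^esub>, x)" "(\<zero>\<^bsub>R\<^esub>, y)"] by (simp add: B_def)
    show "r \<otimes>\<^bsub>S\<^esub> x \<in> B" if "r \<in> carrier S" "x \<in> B" for r x
      using that I.I_l_closed[of "(\<zero>\<^bsub>R\<^esub>, x)" "(\<zero>\<^bsub>R\<^esub>, r)"] by (simp add: B_def)
  qed (use I.zero_closed in \<open>auto simp: B_def\<close>)
  then obtain b where b: "b \<in> B"
    "\<And>x. x \<in> B \<Longrightarrow> \<exists>s\<in>nonzerodivisors S. \<exists>r\<in>carrier S. s \<otimes>\<^bsub>S\<^esub> x = r \<otimes>\<^bsub>S\<^esub> b"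
    using assms(4) unfolding generically_principal_def by metis
  have ab: "(a, b) \<in> I"
    using a(1) b(1) I.a_closed[of "(a, \<zero>\<^bsub>S\<^esub>)" "(\<zero>\<^bsub>R\<^esub>, b)"] by (simp add: A_def B_def)
  show "\<exists>a\<in>I. \<forall>x\<in>I. \<exists>s\<in>nonzerodivisors ?P. \<exists>r\<in>carrier ?P. s \<otimes>\<^bsub>?P\<^esub> x = r \<otimes>\<^bsub>?P\<^esub> a"
  proof (intro bexI[OF _ ab] ballI)
    fix z assume z: "z \<in> I"
    obtain x y where xy: "z = (x, y)" "x \<in> carrier R" "y \<in> carrier S" using I.Icarr[OF z] by auto
    have "x \<in> A"
      using I.I_l_closed[OF z, of "(\<one>\<^bsub>R\<^esub>, \<zero>\<^bsub>S\<^esub>)"] xy by (simp add: A_def)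
    then obtain s r where s: "s \<in> nonzerodivisors R" "r \<in> carrier R" "s \<otimes>\<^bsub>R\<^esub> x = r \<otimes>\<^bsub>R\<^esub> a"
      using a by blast
    have "y \<in> B"
      using I.I_l_closed[OF z, of "(\<zero>\<^bsub>R\<^esub>, \<one>\<^bsub>S\<^esub>)"] xy by (simp add: B_def)
    then obtain t q where t: "t \<in> nonzerodivisors S" "q \<in> carrier S" "t \<otimes>\<^bsub>S\<^esub> y = q \<otimes>\<^bsub>S\<^esub> b"
      using b by blast
    have "(s, t) \<in> nonzerodivisors ?P"
      using s t by (intro P.nzdI) (auto intro: R.nzd_zero S.nzd_zero)
    then show "\<exists>s\<in>nonzerodivisors ?P. \<exists>r\<in>carrier ?P. s \<otimes>\<^bsub>?P\<^esub> z = r \<otimes>\<^bsub>?P\<^esub> (a, b)"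
      using s t xy by (intro bexI[of _ "(s, t)"] bexI[of _ "(r, q)"]) auto
  qed
qed

text \<open>Lets the product over a list inherit commutativity from a binary product.\<close>

lemma ring_iso_cring:
  assumes h: "h \<in> ring_iso R S" and "cring R" "ring S"
  shows "cring S"
proof -
  interpret R: cring R by fact
  interpret S: ring S by fact
  have b: "h ` carrier R = carrier S" using h by (auto simp: ring_iso_def bij_betw_def)
  have "x \<otimes>\<^bsub>S\<^esub> y = y \<otimes>\<^bsub>S\<^esub> x" if "x \<in> carrier S" "y \<in> carrier S" for x y
  proof -
    have "x \<in> h ` carrier R" "y \<in> h ` carrier R" using that by (simp_all only: b)
    then obtain u v where uv: "u \<in> carrier R" "v \<in> carrier R" "x = h u" "y = h v" by blast
    then have "x \<otimes>\<^bsub>S\<^esub> y = h (u \<otimes>\<^bsub>R\<^esub> v)" using ring_iso_memE(2)[OF h] by simp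
    also have "\<dots> = h (v \<otimes>\<^bsub>R\<^esub> u)" using uv by (simp add: R.m_comm)
    also have "\<dots> = y \<otimes>\<^bsub>S\<^esub> x" using uv ring_iso_memE(2)[OF h] by simp
    finally show ?thesis .
  qed
  then show ?thesis by unfold_locales auto
qed

lemma ring_iso_generically_principal:
  assumes h: "h \<in> ring_iso R S" and "cring R" "cring S" "generically_principal R"
  shows "generically_principal S"
  unfolding generically_principal_def
proof (intro allI impI)
  interpret R: cring R by fact
  interpret S: cring S by fact
  have hom: "h \<in> ring_hom R S" and b: "h ` carrier R = carrier S" and inj: "inj_on h (carrier R)"
    using h by (auto simp: ring_iso_def bij_betw_def)
  have h0: "h \<zero>\<^bsub>R\<^esub> = \<zero>\<^bsub>S\<^esub>" using ring_hom_zero[OF hom R.ring_axioms S.ring_axioms] .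
  fix I assume "ideal I S"
  then interpret I: ideal I S .
  define J where "J = {x \<in> carrier R. h x \<in> I}"
  have "ideal J R"
    by (rule R.ideal_criterion)
      (auto simp: J_def h0 ring_hom_add[OF hom] ring_hom_mult[OF hom] ring_hom_closed[OF hom] I.I_l_closed)
  then obtain a where a: "a \<in> J"
    "\<And>x. x \<in> J \<Longrightarrow> \<exists>s\<in>nonzerodivisors R. \<exists>r\<in>carrier R. s \<otimes>\<^bsub>R\<^esub> x = r \<otimes>\<^bsub>R\<^esub> a"
    using assms(4) unfolding generically_principal_def by metis
  then have ha: "h a \<in> I" by (simp add: J_def)
  show "\<exists>a\<in>I. \<forall>x\<in>I. \<exists>s\<in>nonzerodivisors S. \<exists>r\<in>carrier S. s \<otimes>\<^bsub>S\<^esub> x = r \<otimes>\<^bsub>S\<^esub> a"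
  proof (intro bexI[OF _ ha] ballI)
    fix y assume y: "y \<in> I"
    then obtain x where x: "x \<in> carrier R" "y = h x" using b I.Icarr by blast
    then have "x \<in> J" using y by (simp add: J_def)
    then obtain s r where s: "s \<in> nonzerodivisors R" "r \<in> carrier R" "s \<otimes>\<^bsub>R\<^esub> x = r \<otimes>\<^bsub>R\<^esub> a"
      using a(2) by blast
    have sc: "s \<in> carrier R" "a \<in> carrier R" using s(1) a(1) by (auto simp: J_def)
    have "h s \<in> nonzerodivisors S"
    proof (rule S.nzdI)
      fix z assume z: "z \<in> carrier S" "h s \<otimes>\<^bsub>S\<^esub> z = \<zero>\<^bsub>S\<^esub>"
      then obtain w where w: "w \<in> carrier R" "z = h w" using b by blast
      then have "h (s \<otimes>\<^bsub>R\<^esub> w) = h \<zero>\<^bsub>R\<^esub>" using z sc h0 ring_hom_mult[OF hom] by simp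
      then have "s \<otimes>\<^bsub>R\<^esub> w = \<zero>\<^bsub>R\<^esub>" using inj_onD[OF inj] w sc by blast
      then show "z = \<zero>\<^bsub>S\<^esub>" using R.nzd_zero[OF s(1) w(1)] w h0 by simp
    qed (use sc ring_hom_closed[OF hom] in blast)
    moreover have "h s \<otimes>\<^bsub>S\<^esub> y = h r \<otimes>\<^bsub>S\<^esub> h a"
      using s(2,3) x sc ring_hom_mult[OF hom] by metis
    ultimately show "\<exists>s\<in>nonzerodivisors S. \<exists>r\<in>carrier S. s \<otimes>\<^bsub>S\<^esub> y = r \<otimes>\<^bsub>S\<^esub> h a"
      using s(2) ring_hom_closed[OF hom] by blast
  qed
qed

lemma RDirProd_list_generically_principal:
  assumes "\<And>S. S \<in> set Rs \<Longrightarrow> cring S \<and> generically_principal S"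
  shows "cring (RDirProd_list Rs) \<and> generically_principal (RDirProd_list Rs)"
  using assms
proof (induction Rs)
  case Nil
  interpret ring "nil_ring :: 'a list ring" using RDirProd_list_is_ring[of "[]"] by simp
  have c: "cring (nil_ring :: 'a list ring)" by unfold_locales (auto simp: monoid.defs)
  have "generically_principal (nil_ring :: 'a list ring)"
    unfolding generically_principal_def
  proof (intro allI impI)
    fix I assume "ideal I (nil_ring :: 'a list ring)"
    then interpret I: ideal I "nil_ring :: 'a list ring" .
    \<comment> \<open>The empty product is the zero ring, whose only element is both zero and
      regular.\<close>
    have "\<zero>\<^bsub>nil_ring :: 'a list ring\<^esub> = []" by (simp add: monoid.defs)
    then have "[] \<in> I" using I.zero_closed by metis
    then have "I = {[]}" using I.Icarr by auto
    moreover have "[] \<in> nonzerodivisors (nil_ring :: 'a list ring)"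
      by (auto simp: nonzerodivisors_def monoid.defs)
    ultimately show "\<exists>a\<in>I. \<forall>x\<in>I. \<exists>s\<in>nonzerodivisors nil_ring. \<exists>r\<in>carrier nil_ring.
        s \<otimes>\<^bsub>nil_ring\<^esub> x = r \<otimes>\<^bsub>nil_ring\<^esub> a"
      by auto
  qed
  with c show ?case by simp
next
  case (Cons S Rs)
  then have S: "cring S" "generically_principal S" and
    Rs: "cring (RDirProd_list Rs)" "generically_principal (RDirProd_list Rs)" by auto
  have "ring (RDirProd_list (S # Rs))"
    using Cons.prems by (intro RDirProd_list_is_ring) (meson cring.axioms(1) nth_mem)
  then have "cring (RDirProd_list (S # Rs))"
    using ring_iso_cring[OF RDirProd_list_iso1 RDirProd_cring[OF S(1) Rs(1)]] by simp
  then show ?case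
    using ring_iso_generically_principal[OF RDirProd_list_iso1 RDirProd_cring[OF S(1) Rs(1)]]
      RDirProd_generically_principal[OF S(1) Rs(1) S(2) Rs(2)] by simp
qed

lemma general_krull_imp_generically_principal:
  fixes R :: "('a, 'b) ring_scheme"
  assumes "general_krull_ring R"
  shows "generically_principal R"
proof -
  obtain Rs :: "'a ring list" where Rs: "\<forall>S \<in> set Rs. krull_domain S \<or> special_primary_ring S"
    "R \<simeq> RDirProd_list Rs" and R: "cring R"
    using assms unfolding general_krull_ring_def by blast
  have "cring S \<and> generically_principal S" if "S \<in> set Rs" for S
    using bspec[OF Rs(1) that] domain.domain_generically_principal[of S]
      special_primary_ring.special_primary_generically_principal[of S]
    by (auto simp: krull_domain_def domain_def special_primary_ring_def)
  then have P: "cring (RDirProd_list Rs)" "generically_principal (RDirProd_list Rs)"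
    using RDirProd_list_generically_principal by blast+
  obtain h where "h \<in> ring_iso R (RDirProd_list Rs)" using Rs(2) by (auto simp: is_ring_iso_def)
  then have "inv_into (carrier R) h \<in> ring_iso (RDirProd_list Rs) R"
    using ring_iso_set_sym cring.axioms(1)[OF R] by blast
  then show ?thesis using ring_iso_generically_principal P R by blast
qed

section \<open>Corner rings\<close>

text \<open>The ring \<open>e R\<close>. It stays on the element type of \<open>R\<close>, as the
  factors of a general Krull ring must, and membership is the equation
  \<open>e x = x\<close>.\<close>

definition corner :: "('a, 'b) ring_scheme \<Rightarrow> 'a \<Rightarrow> 'a ring"
  where "corner R e = \<lparr> carrier = {x \<in> carrier R. e \<otimes>\<^bsub>R\<^esub> x = x}, monoid.mult = monoid.mult R,
    monoid.one = e, ring.zero = \<zero>\<^bsub>R\<^esub>, ring.add = ring.add R \<rparr>"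

lemma corner_simps [simp]:
  "x \<in> carrier (corner R e) \<longleftrightarrow> x \<in> carrier R \<and> e \<otimes>\<^bsub>R\<^esub> x = x"
  "x \<otimes>\<^bsub>corner R e\<^esub> y = x \<otimes>\<^bsub>R\<^esub> y"
  "x \<oplus>\<^bsub>corner R e\<^esub> y = x \<oplus>\<^bsub>R\<^esub> y"
  "\<one>\<^bsub>corner R e\<^esub> = e"
  "\<zero>\<^bsub>corner R e\<^esub> = \<zero>\<^bsub>R\<^esub>"
  by (auto simp: corner_def)

locale cring_idempotent = cring +
  fixes e
  assumes e_closed [simp, intro]: "e \<in> carrier R" and e_idem [simp]: "e \<otimes> e = e"
begin

lemma e_absorb [simp]: "x \<in> carrier R \<Longrightarrow> e \<otimes> (e \<otimes> x) = e \<otimes> x"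
  by (simp add: m_assoc[symmetric])

lemma corner_cring: "cring (corner R e)"
proof (intro cringI abelian_groupI comm_monoidI)
  fix x assume "x \<in> carrier (corner R e)"
  then show "\<exists>y\<in>carrier (corner R e). y \<oplus>\<^bsub>corner R e\<^esub> x = \<zero>\<^bsub>corner R e\<^esub>"
    by (intro bexI[of _ "\<ominus> x"]) (auto simp: l_neg r_minus)
qed (auto simp: m_ac a_ac l_distr r_distr)

sublocale corner: cring "corner R e" by (rule corner_cring)

text \<open>The complementary idempotent. Adding it to an element of \<open>e R\<close> gives an
  element that acts as the identity on the other factor.\<close>

definition "f = \<one> \<ominus> e"

lemma f_closed [simp, intro]: "f \<in> carrier R"
  by (simp add: f_def)

lemma e_f [simp]: "e \<otimes> f = \<zero>" "f \<otimes> e = \<zero>"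
  by (simp_all add: f_def a_minus_def r_distr l_distr r_minus l_minus r_neg)

lemma e_plus_f: "e \<oplus> f = \<one>"
  by (simp add: f_def a_minus_def a_lcomm[of e \<one>] r_neg)

lemma f_corner [simp]:
  assumes "x \<in> carrier R" "e \<otimes> x = x"
  shows "f \<otimes> x = \<zero>" "x \<otimes> f = \<zero>"
proof -
  have "f \<otimes> x = f \<otimes> (e \<otimes> x)" using assms by simp
  also have "\<dots> = \<zero>" using assms(1) by (simp add: m_assoc[symmetric])
  finally show "f \<otimes> x = \<zero>" .
  then show "x \<otimes> f = \<zero>" using assms by (simp add: m_comm)
qed

text \<open>On \<open>e R\<close> a multiplier \<open>r\<close> acts as \<open>e r\<close>.
  Conditions on all ideals of \<open>R\<close> thus apply directly to ideals of the corner.\<close>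

lemma corner_ideal:
  assumes "ideal I (corner R e)"
  shows "ideal I R"
proof (rule ideal_criterion)
  interpret I: ideal I "corner R e" by fact
  show "I \<subseteq> carrier R" using I.Icarr by auto
  show "\<zero> \<in> I" using I.zero_closed by simp
  show "x \<oplus> y \<in> I" if "x \<in> I" "y \<in> I" for x y using I.a_closed that by simp
  show "r \<otimes> x \<in> I" if r: "r \<in> carrier R" "x \<in> I" for r x
  proof -
    have x: "x \<in> carrier R" "e \<otimes> x = x" using I.Icarr[OF r(2)] by auto
    have "r \<otimes> x = (e \<otimes> r) \<otimes> x" using r x by (metis e_closed m_assoc m_comm)
    moreover have "e \<otimes> r \<in> carrier (corner R e)" using r by simp
    ultimately show ?thesis using I.I_l_closed[OF r(2)] by (metis corner_simps(2))
  qed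
qed

text \<open>A finite set generating an ideal of the corner over \<open>R\<close> also generates it
  over the corner, because the ideal generated there is again an ideal of \<open>R\<close>.\<close>

lemma corner_noetherian:
  assumes "noetherian_ring R"
  shows "noetherian_ring (corner R e)"
proof (rule corner.noetherian_ringI)
  fix I assume I: "ideal I (corner R e)"
  obtain A where A: "A \<subseteq> carrier R" "finite A" "I = Idl A"
    using noetherian_ring.finetely_gen[OF assms corner_ideal[OF I]] by blast
  have AI: "A \<subseteq> I" using genideal_self[OF A(1)] A(3) by simp
  then have AC: "A \<subseteq> carrier (corner R e)" using ideal.Icarr[OF I] by blast
  have "Idl\<^bsub>corner R e\<^esub> A \<subseteq> I" using corner.genideal_minimal[OF I AI] .
  moreover have "I \<subseteq> Idl\<^bsub>corner R e\<^esub> A"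
    unfolding A(3)
    using genideal_minimal[OF corner_ideal[OF corner.genideal_ideal[OF AC]] corner.genideal_self[OF AC]] .
  ultimately show "\<exists>A\<subseteq>carrier (corner R e). finite A \<and> I = Idl\<^bsub>corner R e\<^esub> A"
    using A(2) AC by blast
qed

lemma corner_nzd:
  assumes "s \<in> nonzerodivisors R"
  shows "e \<otimes> s \<in> nonzerodivisors (corner R e)"
proof (rule corner.nzdI)
  fix a assume a: "a \<in> carrier (corner R e)" "(e \<otimes> s) \<otimes>\<^bsub>corner R e\<^esub> a = \<zero>\<^bsub>corner R e\<^esub>"
  have ac: "a \<in> carrier R" "e \<otimes> a = a" using a(1) by auto
  have sc: "s \<in> carrier R" using assms by (rule nzd_closed)
  have "(e \<otimes> s) \<otimes> a = s \<otimes> (e \<otimes> a)" using ac(1) sc by (simp add: m_ac)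
  then show "a = \<zero>\<^bsub>corner R e\<^esub>" using a(2) ac nzd_zero[OF assms ac(1)] by simp
qed (use assms nzd_closed in simp)

text \<open>\<open>s \<oplus> f\<close> acts as \<open>s\<close> on \<open>e R\<close> and as the
  identity on \<open>f R\<close>, and an element vanishes once both of its components do.\<close>

lemma nzd_plus_f:
  assumes "s \<in> nonzerodivisors (corner R e)"
  shows "s \<oplus> f \<in> nonzerodivisors R"
proof (rule nzdI)
  have s: "s \<in> carrier R" "e \<otimes> s = s" using corner.nzd_closed[OF assms] by auto
  then show "s \<oplus> f \<in> carrier R" by simp
  fix a assume a: "a \<in> carrier R" "(s \<oplus> f) \<otimes> a = \<zero>"
  have "s \<otimes> (e \<otimes> a) = (e \<otimes> (s \<oplus> f)) \<otimes> a"
    using s a(1) by (simp add: r_distr) (metis e_closed m_assoc m_comm)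
  also have "\<dots> = e \<otimes> ((s \<oplus> f) \<otimes> a)" using s a(1) by (simp add: m_assoc)
  finally have "s \<otimes> (e \<otimes> a) = \<zero>" using a by simp
  then have ea: "e \<otimes> a = \<zero>" using corner.nzd_zero[OF assms, of "e \<otimes> a"] a by simp
  have "s \<otimes> a = s \<otimes> (e \<otimes> a)" using s a(1) by (metis e_closed m_assoc m_comm)
  then have "s \<otimes> a = \<zero>" using ea s by simp
  then have "f \<otimes> a = \<zero>" using a s by (simp add: l_distr)
  then have "(e \<oplus> f) \<otimes> a = \<zero>" using ea a(1) by (simp add: l_distr)
  then show "a = \<zero>" using a(1) by (simp add: e_plus_f)
qed

text \<open>The factor \<open>e\<close> matters for \<open>n = 0\<close>, where the power in the
  corner is \<open>e\<close> and the one in \<open>R\<close> is \<open>\<one>\<close>.\<close>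

lemma corner_pow:
  assumes "x \<in> carrier R" "e \<otimes> x = x"
  shows "x [^]\<^bsub>corner R e\<^esub> (n::nat) = e \<otimes> x [^] n"
  by (induction n) (use assms in \<open>simp_all add: m_assoc\<close>)

lemma corner_generically_principal:
  assumes "generically_principal R"
  shows "generically_principal (corner R e)"
  unfolding generically_principal_def
proof (intro allI impI)
  fix I assume I: "ideal I (corner R e)"
  obtain a where a: "a \<in> I" "\<And>x. x \<in> I \<Longrightarrow> \<exists>s\<in>nonzerodivisors R. \<exists>r\<in>carrier R. s \<otimes> x = r \<otimes> a"
    using assms corner_ideal[OF I] unfolding generically_principal_def by metis
  show "\<exists>a\<in>I. \<forall>x\<in>I. \<exists>s\<in>nonzerodivisors (corner R e). \<exists>r\<in>carrier (corner R e).
      s \<otimes>\<^bsub>corner R e\<^esub> x = r \<otimes>\<^bsub>corner R e\<^esub> a"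
  proof (intro bexI[OF _ a(1)] ballI)
    fix x assume x: "x \<in> I"
    obtain s r where s: "s \<in> nonzerodivisors R" "r \<in> carrier R" "s \<otimes> x = r \<otimes> a"
      using a(2)[OF x] by blast
    have c: "x \<in> carrier R" "a \<in> carrier R" using ideal.Icarr[OF I x] ideal.Icarr[OF I a(1)] by auto
    have "(e \<otimes> s) \<otimes> x = (e \<otimes> r) \<otimes> a" using c s nzd_closed[OF s(1)] by (simp add: m_assoc)
    then show "\<exists>s\<in>nonzerodivisors (corner R e). \<exists>r\<in>carrier (corner R e).
        s \<otimes>\<^bsub>corner R e\<^esub> x = r \<otimes>\<^bsub>corner R e\<^esub> a"
      using corner_nzd[OF s(1)] s(2) by (intro bexI[of _ "e \<otimes> s"] bexI[of _ "e \<otimes> r"]) auto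
  qed
qed

text \<open>\<open>s\<close> and \<open>c\<close> are lifted to regular elements of \<open>R\<close>
  by adding \<open>f\<close>, while \<open>a\<close> is kept. In positive powers \<open>a\<close> is
  killed by \<open>f\<close>, so the relations lift; multiplying the result by \<open>e\<close>
  leads back to the corner.\<close>

lemma corner_completely_integrally_closed:
  assumes "completely_integrally_closed R"
  shows "completely_integrally_closed (corner R e)"
  unfolding completely_integrally_closed_def
proof (intro ballI impI)
  let ?C = "corner R e"
  fix a s c
  assume a': "a \<in> carrier ?C" and s': "s \<in> nonzerodivisors ?C" and c': "c \<in> nonzerodivisors ?C"
    and h: "\<forall>n::nat. \<exists>r\<in>carrier ?C. c \<otimes>\<^bsub>?C\<^esub> a [^]\<^bsub>?C\<^esub> n = r \<otimes>\<^bsub>?C\<^esub> s [^]\<^bsub>?C\<^esub> n"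
  have a: "a \<in> carrier R" "e \<otimes> a = a" using a' by auto
  have s: "s \<in> carrier R" "e \<otimes> s = s" using corner.nzd_closed[OF s'] by auto
  have c: "c \<in> carrier R" "e \<otimes> c = c" using corner.nzd_closed[OF c'] by auto
  have es: "e \<otimes> (s \<oplus> f) [^] n = e \<otimes> s [^] n" for n :: nat
  proof (induction n)
    case (Suc n)
    have "e \<otimes> (s \<oplus> f) [^] Suc n = (e \<otimes> (s \<oplus> f) [^] n) \<otimes> (e \<otimes> (s \<oplus> f))"
      using s(1) by (simp add: m_ac)
    also have "\<dots> = (e \<otimes> s [^] n) \<otimes> s" using s by (simp add: Suc r_distr)
    finally show ?case using s(1) by (simp add: m_assoc)
  qed simp
  have "\<exists>r\<in>carrier R. (c \<oplus> f) \<otimes> a [^] n = r \<otimes> (s \<oplus> f) [^] n" for n :: nat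
  proof (cases n)
    \<comment> \<open>The power of \<open>a\<close> is now \<open>\<one>\<close>, which
      \<open>f\<close> need not kill; \<open>c \<oplus> f\<close> itself is the witness.\<close>
    case 0
    then show ?thesis using c by (intro bexI[of _ "c \<oplus> f"]) auto
  next
    case (Suc m)
    obtain r where r: "r \<in> carrier R" "e \<otimes> r = r" "c \<otimes> (e \<otimes> a [^] n) = r \<otimes> (e \<otimes> s [^] n)"
    proof -
      obtain r where "r \<in> carrier ?C" "c \<otimes>\<^bsub>?C\<^esub> a [^]\<^bsub>?C\<^esub> n = r \<otimes>\<^bsub>?C\<^esub> s [^]\<^bsub>?C\<^esub> n"
        using h by blast
      with a s show thesis by (intro that[of r]) (simp_all add: corner_pow)
    qed
    have "f \<otimes> a [^] n = (f \<otimes> a) \<otimes> a [^] m" using a(1) by (simp add: Suc m_ac)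
    then have "f \<otimes> a [^] n = \<zero>" using a by simp
    then have "(c \<oplus> f) \<otimes> a [^] n = c \<otimes> a [^] n" using a c by (simp add: l_distr)
    also have "\<dots> = c \<otimes> (e \<otimes> a [^] n)" using a c by (metis e_closed m_assoc m_comm nat_pow_closed)
    also have "\<dots> = r \<otimes> (e \<otimes> (s \<oplus> f) [^] n)" by (simp only: r(3) es)
    also have "\<dots> = (e \<otimes> r) \<otimes> (s \<oplus> f) [^] n" using r(1) s by (simp add: m_ac)
    finally show ?thesis using r by auto
  qed
  then obtain r where r: "r \<in> carrier R" "a = r \<otimes> (s \<oplus> f)"
    using assms a(1) nzd_plus_f[OF s'] nzd_plus_f[OF c']
    unfolding completely_integrally_closed_def by meson
  have "a = e \<otimes> (r \<otimes> (s \<oplus> f))" using a r by simp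
  also have "\<dots> = r \<otimes> (e \<otimes> (s \<oplus> f))" using r(1) s by (simp add: m_ac)
  also have "\<dots> = r \<otimes> (e \<otimes> s)" using s by (simp add: r_distr)
  also have "\<dots> = (e \<otimes> r) \<otimes> s" using r(1) s(1) by (simp add: m_ac)
  finally show "\<exists>r\<in>carrier ?C. a = r \<otimes>\<^bsub>?C\<^esub> s" using r(1) by (intro bexI[of _ "e \<otimes> r"]) auto
qed

end

section \<open>Reassembling products along orthogonal idempotents\<close>

lemma RDirProd_list_append:
  "RDirProd (RDirProd_list Rs) (RDirProd_list Ss) \<simeq> RDirProd_list (Rs @ Ss)"
proof (induction Rs)
  case Nil
  have "(\<lambda>(x, y). y) \<in> ring_iso (RDirProd nil_ring (RDirProd_list Ss)) (RDirProd_list Ss)"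
    unfolding ring_iso_def ring_hom_def bij_betw_def inj_on_def
    by (auto simp: RDirProd_def DirProd_def monoid.defs image_iff)
  then show ?case by (auto simp: is_ring_iso_def)
next
  case (Cons R Rs)
  then obtain g where "g \<in> ring_iso (RDirProd (RDirProd_list Rs) (RDirProd_list Ss)) (RDirProd_list (Rs @ Ss))"
    by (auto simp: is_ring_iso_def)
  \<comment> \<open>The chain unfolds \<open>R # Rs\<close>, reassociates, applies the induction
    hypothesis to the right factor and folds the list again.\<close>
  note isos = ring_iso_set_trans[OF ring_iso_set_trans[OF ring_iso_set_trans[OF
        RDirProd_iso4[OF RDirProd_list_iso2] RDirProd_iso3] RDirProd_iso5[OF this]] RDirProd_list_iso1]
  show ?case
    using isos[of R] unfolding is_ring_iso_def by auto
qed

context cring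
begin

text \<open>The inverse adds the two components; orthogonality removes the mixed terms.\<close>

lemma corner_add_iso:
  assumes g: "g \<in> carrier R" "g \<otimes> g = g" and h: "h \<in> carrier R" "h \<otimes> h = h" and gh: "g \<otimes> h = \<zero>"
  shows "(\<lambda>x. (g \<otimes> x, h \<otimes> x)) \<in> ring_iso (corner R (g \<oplus> h)) (RDirProd (corner R g) (corner R h))"
proof -
  have hg: "h \<otimes> g = \<zero>" using g h gh by (simp add: m_comm)
  have absorb: "g \<otimes> (g \<otimes> x) = g \<otimes> x" "h \<otimes> (h \<otimes> x) = h \<otimes> x"
    "g \<otimes> (h \<otimes> x) = \<zero>" "h \<otimes> (g \<otimes> x) = \<zero>" if "x \<in> carrier R" for x
    using that g h gh hg by (simp_all add: m_assoc[symmetric])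
  show ?thesis
  proof (rule ring_iso_memI)
    fix x assume x: "x \<in> carrier (corner R (g \<oplus> h))"
    then show "(g \<otimes> x, h \<otimes> x) \<in> carrier (RDirProd (corner R g) (corner R h))"
      using g h by (simp add: absorb)
    fix y assume y: "y \<in> carrier (corner R (g \<oplus> h))"
    have "(k \<otimes> x) \<otimes> (k \<otimes> y) = k \<otimes> (x \<otimes> y)" if "k \<in> carrier R" "k \<otimes> k = k" for k
    proof -
      have "(k \<otimes> x) \<otimes> (k \<otimes> y) = (k \<otimes> k) \<otimes> (x \<otimes> y)" using that(1) x y by (simp add: m_ac)
      then show ?thesis using that by simp
    qed
    then show "(g \<otimes> (x \<otimes>\<^bsub>corner R (g \<oplus> h)\<^esub> y), h \<otimes> (x \<otimes>\<^bsub>corner R (g \<oplus> h)\<^esub> y))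
        = (g \<otimes> x, h \<otimes> x) \<otimes>\<^bsub>RDirProd (corner R g) (corner R h)\<^esub> (g \<otimes> y, h \<otimes> y)"
      using g h by simp
    show "(g \<otimes> (x \<oplus>\<^bsub>corner R (g \<oplus> h)\<^esub> y), h \<otimes> (x \<oplus>\<^bsub>corner R (g \<oplus> h)\<^esub> y))
        = (g \<otimes> x, h \<otimes> x) \<oplus>\<^bsub>RDirProd (corner R g) (corner R h)\<^esub> (g \<otimes> y, h \<otimes> y)"
      using x y g h by (simp add: r_distr)
  next
    show "(g \<otimes> \<one>\<^bsub>corner R (g \<oplus> h)\<^esub>, h \<otimes> \<one>\<^bsub>corner R (g \<oplus> h)\<^esub>) = \<one>\<^bsub>RDirProd (corner R g) (corner R h)\<^esub>"
      using g h gh hg by (simp add: r_distr)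
  next
    show "bij_betw (\<lambda>x. (g \<otimes> x, h \<otimes> x)) (carrier (corner R (g \<oplus> h))) (carrier (RDirProd (corner R g) (corner R h)))"
      by (rule bij_betw_byWitness[of _ "\<lambda>(x, y). x \<oplus> y"])
        (use g h absorb in \<open>auto simp: l_distr r_distr\<close>, (metis absorb(3,4) l_zero r_zero)+)
  qed
qed

end

section \<open>Discrete valuations from prime poles\<close>

text \<open>The domain is placed inside its quotient field, so that poles and conductors need no
  explicit fractions. \<open>closed\<close> is complete integral closedness,
  \<open>fractions\<close> says that \<open>K\<close> is the quotient field.\<close>

locale noetherian_closed_subring = field K for K (structure) +
  fixes D
  assumes D_subring: "subring D K"
    and noetherian: "noetherian_ring (K\<lparr>carrier := D\<rparr>)"
    and closed: "\<lbrakk>x \<in> carrier K; c \<in> D; c \<noteq> \<zero>; \<And>n::nat. c \<otimes> x [^] n \<in> D\<rbrakk> \<Longrightarrow> x \<in> D"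
    and fractions: "x \<in> carrier K \<Longrightarrow> \<exists>s \<in> D. s \<noteq> \<zero> \<and> s \<otimes> x \<in> D"
begin

lemma D_carrier [simp, intro]: "x \<in> D \<Longrightarrow> x \<in> carrier K"
  using subringE(1)[OF D_subring] by blast

lemma D_zero [simp, intro]: "\<zero> \<in> D" and D_one [simp, intro]: "\<one> \<in> D"
  and D_add [simp, intro]: "\<lbrakk>x \<in> D; y \<in> D\<rbrakk> \<Longrightarrow> x \<oplus> y \<in> D"
  and D_mult [simp, intro]: "\<lbrakk>x \<in> D; y \<in> D\<rbrakk> \<Longrightarrow> x \<otimes> y \<in> D"
  using subringE[OF D_subring] by blast+

lemma D_pow [simp, intro]: "x \<in> D \<Longrightarrow> x [^] (n::nat) \<in> D"
  by (induction n) auto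

lemma K_cancel: "\<lbrakk>x \<in> carrier K; y \<in> carrier K; z \<in> carrier K; x \<noteq> \<zero>; x \<otimes> y = x \<otimes> z\<rbrakk> \<Longrightarrow> y = z"
  using m_lcancel by blast

lemma D_ideal:
  assumes "I \<subseteq> D" "\<zero> \<in> I" "\<And>x y. \<lbrakk>x \<in> I; y \<in> I\<rbrakk> \<Longrightarrow> x \<oplus> y \<in> I"
    and "\<And>r x. \<lbrakk>r \<in> D; x \<in> I\<rbrakk> \<Longrightarrow> r \<otimes> x \<in> I"
  shows "ideal I (K\<lparr>carrier := D\<rparr>)"
proof -
  have "cring (K\<lparr>carrier := D\<rparr>)"
    using subring_is_domain[OF D_subring] by (simp add: domain_def)
  then show ?thesis
    using assms by (intro cring.ideal_criterion) auto
qed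

definition "conductor x = {y \<in> D. y \<otimes> x \<in> D}"

lemma conductor_ideal:
  assumes "x \<in> carrier K"
  shows "ideal (conductor x) (K\<lparr>carrier := D\<rparr>)"
  by (rule D_ideal) (use assms in \<open>auto simp: conductor_def l_distr m_assoc\<close>)

text \<open>The conductors of prime poles are the primes of height one.\<close>

definition "prime_pole x \<longleftrightarrow> x \<in> carrier K \<and> x \<notin> D \<and>
  (\<forall>y \<in> D. \<forall>z \<in> D. y \<otimes> z \<in> conductor x \<longrightarrow> y \<in> conductor x \<or> z \<in> conductor x)"

text \<open>The conductor of \<open>r \<otimes> z\<close> is the annihilator of its class in the
  module \<open>K / D\<close>. A maximal one among the annihilators of non-zero multiples of a class
  is prime.\<close>

lemma prime_pole_exists:
  assumes "z \<in> carrier K" "z \<notin> D"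
  obtains r where "r \<in> D" "prime_pole (r \<otimes> z)"
proof -
  define F where "F = {conductor (r \<otimes> z) | r. r \<in> D \<and> r \<otimes> z \<notin> D}"
  have "conductor (\<one> \<otimes> z) \<in> F" unfolding F_def using assms by (intro CollectI exI[of _ \<one>]) simp
  then have F: "F \<noteq> {}" by blast
  have "ideal I (K\<lparr>carrier := D\<rparr>)" if "I \<in> F" for I
    using that assms(1) conductor_ideal by (auto simp: F_def)
  then obtain M where M: "M \<in> F" "\<And>J. \<lbrakk>J \<in> F; M \<subseteq> J\<rbrakk> \<Longrightarrow> J = M"
    using noetherian_ring.maximal_element[OF noetherian F] by metis
  then obtain r where r: "r \<in> D" "r \<otimes> z \<notin> D" "M = conductor (r \<otimes> z)" by (auto simp: F_def)
  have "prime_pole (r \<otimes> z)"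
    unfolding prime_pole_def
  proof (intro conjI ballI impI)
    fix y w assume yw: "y \<in> D" "w \<in> D" "y \<otimes> w \<in> conductor (r \<otimes> z)"
    show "y \<in> conductor (r \<otimes> z) \<or> w \<in> conductor (r \<otimes> z)"
    proof (cases "y \<in> conductor (r \<otimes> z)")
      case False
      \<comment> \<open>Multiplying by \<open>y\<close> stays outside \<open>D\<close> and can only
        enlarge the conductor, hence does not change it by maximality; but the new one contains
        \<open>w\<close>.\<close>
      then have "(y \<otimes> r) \<otimes> z \<notin> D" using yw r assms by (simp add: conductor_def m_assoc)
      then have "conductor ((y \<otimes> r) \<otimes> z) \<in> F" using yw r by (auto simp: F_def)
      moreover have "M \<subseteq> conductor ((y \<otimes> r) \<otimes> z)"
      proof
        fix t assume "t \<in> M"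
        then have t: "t \<in> D" "t \<otimes> (r \<otimes> z) \<in> D" by (auto simp: r(3) conductor_def)
        have "t \<otimes> ((y \<otimes> r) \<otimes> z) = y \<otimes> (t \<otimes> (r \<otimes> z))" using t(1) yw r assms by (simp add: m_ac)
        then show "t \<in> conductor ((y \<otimes> r) \<otimes> z)" using t yw by (simp add: conductor_def)
      qed
      ultimately have "conductor ((y \<otimes> r) \<otimes> z) = M" using M(2) by blast
      moreover have "w \<otimes> ((y \<otimes> r) \<otimes> z) = (y \<otimes> w) \<otimes> (r \<otimes> z)" using yw(1,2) r(1) assms by (simp add: m_ac)
      then have "w \<in> conductor ((y \<otimes> r) \<otimes> z)" using yw by (simp add: conductor_def)
      ultimately show ?thesis by (simp add: r(3))
    qed simp
  qed (use r assms in auto)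
  with r show thesis using that by blast
qed

end

section \<open>The discrete valuation of one prime pole\<close>

locale noetherian_closed_pole = noetherian_closed_subring +
  fixes x
  assumes pole: "prime_pole x"
begin

lemma x_closed [simp, intro]: "x \<in> carrier K" and x_notin: "x \<notin> D"
  and prime: "\<lbrakk>y \<in> D; z \<in> D; y \<otimes> z \<in> conductor x\<rbrakk> \<Longrightarrow> y \<in> conductor x \<or> z \<in> conductor x"
  using pole by (auto simp: prime_pole_def)

lemma one_notin: "\<one> \<notin> conductor x"
  using x_notin by (simp add: conductor_def)

text \<open>Otherwise \<open>y\<close> would be a common denominator of all powers of
  \<open>x\<close>, which forces \<open>x\<close> into \<open>D\<close>.\<close>

lemma leaves_D:
  assumes "y \<in> D" "y \<noteq> \<zero>"
  shows "\<exists>n::nat. y \<otimes> x [^] Suc n \<notin> D"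
proof (rule ccontr)
  assume "\<not> ?thesis"
  then have "y \<otimes> x [^] n \<in> D" for n :: nat using assms by (cases n) auto
  then have "x \<in> D" using closed[OF x_closed assms] by blast
  then show False using x_notin by simp
qed

text \<open>The set of all \<open>n\<close> with \<open>y x\<^sup>n \<in> D\<close> is not visibly closed downwards, so the order is the first
  exit from \<open>D\<close> rather than the last exponent inside \<open>D\<close>.\<close>

definition order :: "'a \<Rightarrow> nat" where "order y = (LEAST n. y \<otimes> x [^] Suc n \<notin> D)"

lemma order_top:
  assumes "y \<in> D" "y \<noteq> \<zero>"
  shows "y \<otimes> x [^] Suc (order y) \<notin> D"
  unfolding order_def using LeastI_ex[OF leaves_D[OF assms]] .

lemma order_below:
  assumes "y \<in> D" "k \<le> order y"
  shows "y \<otimes> x [^] k \<in> D"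
proof (cases k)
  case (Suc m)
  then have "m < order y" using assms by simp
  then show ?thesis using not_less_Least[of m] unfolding order_def Suc by blast
qed (use assms in simp)

lemma order_eqI:
  assumes "\<And>k. k \<le> n \<Longrightarrow> y \<otimes> x [^] k \<in> D" "y \<otimes> x [^] Suc n \<notin> D"
  shows "order y = n"
  unfolding order_def
proof (rule Least_equality)
  show "y \<otimes> x [^] Suc n \<notin> D" by (rule assms(2))
  fix m assume "y \<otimes> x [^] Suc m \<notin> D"
  then show "n \<le> m" using assms(1)[of "Suc m"] by (meson not_less_eq_eq)
qed

text \<open>At their last step before leaving, \<open>u\<close> and \<open>w\<close> lie in
  \<open>D\<close> outside the prime conductor. So does their product, and one more factor
  \<open>x\<close> takes it out of \<open>D\<close>.\<close>

lemma order_mult: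
  assumes y: "y \<in> D" "y \<noteq> \<zero>" and z: "z \<in> D" "z \<noteq> \<zero>"
  shows "order (y \<otimes> z) = order y + order z"
proof (rule order_eqI)
  fix k assume "k \<le> order y + order z"
  then obtain i j where ij: "k = i + j" "i \<le> order y" "j \<le> order z"
    by (metis le_add_diff_inverse nat_le_linear le_diff_conv add.commute add_0_right le0)
  have "(y \<otimes> z) \<otimes> x [^] k = (y \<otimes> x [^] i) \<otimes> (z \<otimes> x [^] j)"
    using y(1) z(1) by (simp add: ij(1) nat_pow_mult[symmetric] m_ac)
  then show "(y \<otimes> z) \<otimes> x [^] k \<in> D" using order_below[OF y(1) ij(2)] order_below[OF z(1) ij(3)] by simp
next
  define u where "u = y \<otimes> x [^] order y"
  define w where "w = z \<otimes> x [^] order z"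
  have u: "u \<in> D" "u \<notin> conductor x"
    using order_below[OF y(1) order.refl] order_top[OF y] y(1) by (auto simp: u_def conductor_def m_assoc)
  have w: "w \<in> D" "w \<notin> conductor x"
    using order_below[OF z(1) order.refl] order_top[OF z] z(1) by (auto simp: w_def conductor_def m_assoc)
  have "(y \<otimes> z) \<otimes> x [^] Suc (order y + order z) = (u \<otimes> w) \<otimes> x"
    using y(1) z(1) by (simp add: u_def w_def nat_pow_mult[symmetric] m_ac)
  then show "(y \<otimes> z) \<otimes> x [^] Suc (order y + order z) \<notin> D"
    using prime[OF u(1) w(1)] u w by (auto simp: conductor_def)
qed

lemma order_add:
  assumes y: "y \<in> D" "y \<noteq> \<zero>" and z: "z \<in> D" "z \<noteq> \<zero>" and yz: "y \<oplus> z \<noteq> \<zero>"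
  shows "min (order y) (order z) \<le> order (y \<oplus> z)"
proof (rule ccontr)
  assume "\<not> ?thesis"
  then have le: "Suc (order (y \<oplus> z)) \<le> order y" "Suc (order (y \<oplus> z)) \<le> order z" by auto
  have "(y \<oplus> z) \<otimes> x [^] Suc (order (y \<oplus> z)) \<in> D"
    using order_below[OF y(1) le(1)] order_below[OF z(1) le(2)] y(1) z(1) by (simp add: l_distr)
  then show False using order_top[of "y \<oplus> z"] y z yz by simp
qed

text \<open>The link between valuations and primes: a positive order on \<open>D\<close> means
  membership in the conductor, whichever pole defines the order.\<close>

lemma order_eq_0_iff:
  assumes "y \<in> D" "y \<noteq> \<zero>"
  shows "order y = 0 \<longleftrightarrow> y \<notin> conductor x"
proof
  assume "order y = 0"
  then show "y \<notin> conductor x" using order_top[OF assms] assms(1) by (simp add: conductor_def)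
next
  assume "y \<notin> conductor x"
  then show "order y = 0" using assms(1) by (intro order_eqI) (auto simp: conductor_def)
qed

lemma order_one [simp]: "order \<one> = 0"
  using order_eq_0_iff[of \<one>] one_notin by simp

text \<open>If \<open>x\<close> multiplied its conductor into itself, a non-zero \<open>c\<close> in
  it would be a common denominator of all powers of \<open>x\<close>. In the localisation at the
  conductor \<open>p \<otimes> x\<close> is a unit, so \<open>p\<close> and \<open>1 / x\<close>
  both generate the maximal ideal.\<close>

lemma uniformizer:
  obtains p where "p \<in> conductor x" "p \<otimes> x \<in> D" "p \<otimes> x \<notin> conductor x"
proof -
  obtain c where c: "c \<in> D" "c \<noteq> \<zero>" "c \<otimes> x \<in> D" using fractions[OF x_closed] by blast
  have "\<exists>p. p \<in> conductor x \<and> p \<otimes> x \<notin> conductor x"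
  proof (rule ccontr)
    assume h: "\<not> ?thesis"
    have "c \<otimes> x [^] n \<in> conductor x" for n :: nat
    proof (induction n)
      case 0
      then show ?case using c by (simp add: conductor_def)
    next
      case (Suc n)
      then have "(c \<otimes> x [^] n) \<otimes> x \<in> conductor x" using h by blast
      then show ?case using c by (simp add: m_assoc)
    qed
    then have "x \<in> D" using closed[OF x_closed c(1,2)] by (auto simp: conductor_def)
    then show False using x_notin by simp
  qed
  then show thesis using that by (auto simp: conductor_def)
qed

text \<open>The denominator is arbitrary; \<open>val_eq\<close> shows that any other one gives the
  same value.\<close>

definition val :: "'a \<Rightarrow> int"
  where "val z = (let s = SOME s. s \<in> D \<and> s \<noteq> \<zero> \<and> s \<otimes> z \<in> D
    in int (order (s \<otimes> z)) - int (order s))"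

text \<open>Additivity of the order, applied to both sides of
  \<open>t (s z) = s (t z)\<close>.\<close>

lemma val_eq:
  assumes z: "z \<in> carrier K" "z \<noteq> \<zero>" and t: "t \<in> D" "t \<noteq> \<zero>" "t \<otimes> z \<in> D"
  shows "val z = int (order (t \<otimes> z)) - int (order t)"
proof -
  define s where "s = (SOME s. s \<in> D \<and> s \<noteq> \<zero> \<and> s \<otimes> z \<in> D)"
  have s: "s \<in> D" "s \<noteq> \<zero>" "s \<otimes> z \<in> D"
    using someI_ex[of "\<lambda>s. s \<in> D \<and> s \<noteq> \<zero> \<and> s \<otimes> z \<in> D"] t unfolding s_def by blast+
  have nz: "s \<otimes> z \<noteq> \<zero>" "t \<otimes> z \<noteq> \<zero>" using s t z integral_iff by auto
  have "t \<otimes> (s \<otimes> z) = s \<otimes> (t \<otimes> z)" using s(1) t(1) z(1) by (simp add: m_ac)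
  then have "order t + order (s \<otimes> z) = order s + order (t \<otimes> z)"
    using order_mult[OF t(1,2) s(3) nz(1)] order_mult[OF s(1,2) t(3) nz(2)] by simp
  then show ?thesis by (simp add: val_def s_def[symmetric])
qed

lemma val_D: "\<lbrakk>z \<in> D; z \<noteq> \<zero>\<rbrakk> \<Longrightarrow> val z = int (order z)"
  using val_eq[of z \<one>] by simp

lemma val_times:
  assumes z: "z \<in> carrier K" "z \<noteq> \<zero>" and w: "w \<in> carrier K" "w \<noteq> \<zero>"
  shows "val (z \<otimes> w) = val z + val w"
proof -
  obtain s where s: "s \<in> D" "s \<noteq> \<zero>" "s \<otimes> z \<in> D" using fractions[OF z(1)] by blast
  obtain t where t: "t \<in> D" "t \<noteq> \<zero>" "t \<otimes> w \<in> D" using fractions[OF w(1)] by blast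
  have nz: "s \<otimes> z \<noteq> \<zero>" "t \<otimes> w \<noteq> \<zero>" "z \<otimes> w \<noteq> \<zero>" "s \<otimes> t \<noteq> \<zero>"
    using s t z w integral_iff by auto
  have eq: "(s \<otimes> t) \<otimes> (z \<otimes> w) = (s \<otimes> z) \<otimes> (t \<otimes> w)" using s(1) t(1) z(1) w(1) by (simp add: m_ac)
  then have "val (z \<otimes> w) = int (order ((s \<otimes> z) \<otimes> (t \<otimes> w))) - int (order (s \<otimes> t))"
    using val_eq[of "z \<otimes> w" "s \<otimes> t"] s t z w nz by simp
  also have "\<dots> = val z + val w"
    using val_eq[OF z s] val_eq[OF w t] order_mult[OF s(3) nz(1) t(3) nz(2)]
      order_mult[OF s(1,2) t(1,2)] by simp
  finally show ?thesis .
qed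

lemma val_plus:
  assumes z: "z \<in> carrier K" "z \<noteq> \<zero>" and w: "w \<in> carrier K" "w \<noteq> \<zero>" and zw: "z \<oplus> w \<noteq> \<zero>"
  shows "min (val z) (val w) \<le> val (z \<oplus> w)"
proof -
  obtain s where s: "s \<in> D" "s \<noteq> \<zero>" "s \<otimes> z \<in> D" using fractions[OF z(1)] by blast
  obtain t where t: "t \<in> D" "t \<noteq> \<zero>" "t \<otimes> w \<in> D" using fractions[OF w(1)] by blast
  define u where "u = s \<otimes> t"
  have "u \<otimes> z = t \<otimes> (s \<otimes> z)" "u \<otimes> w = s \<otimes> (t \<otimes> w)"
    unfolding u_def using s(1) t(1) z(1) w(1) by (simp_all add: m_ac)
  then have u: "u \<in> D" "u \<noteq> \<zero>" "u \<otimes> z \<in> D" "u \<otimes> w \<in> D"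
    using s t integral_iff by (auto simp: u_def)
  have nz: "u \<otimes> z \<noteq> \<zero>" "u \<otimes> w \<noteq> \<zero>" "u \<otimes> (z \<oplus> w) \<noteq> \<zero>"
    using u z w zw integral_iff by auto
  have eq: "u \<otimes> (z \<oplus> w) = u \<otimes> z \<oplus> u \<otimes> w" using u(1) z(1) w(1) by (simp add: r_distr)
  then have "min (order (u \<otimes> z)) (order (u \<otimes> w)) \<le> order (u \<otimes> (z \<oplus> w))"
    using order_add[OF u(3) nz(1) u(4) nz(2)] nz(3) by simp
  moreover have "u \<otimes> (z \<oplus> w) \<in> D" using eq u by simp
  ultimately show ?thesis
    using val_eq[OF z u(1,2,3)] val_eq[OF w u(1,2,4)] val_eq[of "z \<oplus> w" u] z w zw u by simp
qed

lemma val_discrete: "discrete_valuation K val"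
proof (intro discrete_valuation.intro discrete_valuation_axioms.intro field_axioms)
  obtain p where p: "p \<in> conductor x" "p \<otimes> x \<in> D" "p \<otimes> x \<notin> conductor x"
    using uniformizer by blast
  have pD: "p \<in> D" using p by (simp add: conductor_def)
  have p0: "p \<noteq> \<zero>"
    using p by (auto simp: conductor_def)
  \<comment> \<open>\<open>p \<otimes> x\<close> is still in \<open>D\<close> but outside the
    conductor, so the next factor \<open>x\<close> is the first to leave \<open>D\<close>.\<close>
  have "order p = 1"
  proof (rule order_eqI)
    show "p \<otimes> x [^] k \<in> D" if k: "k \<le> 1" for k :: nat
    proof -
      consider "k = 0" | "k = 1" using k by linarith
      then show ?thesis using p(2) pD by cases simp_all
    qed
    show "p \<otimes> x [^] Suc 1 \<notin> D" using p(2,3) pD by (simp add: conductor_def m_assoc)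
  qed
  then have ordp: "order (p [^] n) = n" for n :: nat
  proof (induction n)
    case (Suc n)
    have "p [^] n \<noteq> \<zero>" using p0 pD by (induction n) (auto simp: integral_iff)
    then show ?case using order_mult[of "p [^] n" p] Suc p0 pD by simp
  qed simp
  have pn0: "p [^] n \<noteq> \<zero>" for n :: nat using p0 pD by (induction n) (auto simp: integral_iff)
  have "k \<in> val ` (carrier K - {\<zero>})" for k :: int
  proof (cases k rule: int_cases2)
    case (nonneg n)
    then have "val (p [^] n) = k" using val_D[of "p [^] n"] pD pn0[of n] ordp[of n] by simp
    then show ?thesis using pD pn0[of n] by (metis D_carrier D_pow DiffI image_eqI singletonD)
  next
    case (nonpos n)
    let ?q = "p [^] n"
    have q: "?q \<in> carrier K - {\<zero>}" using pD pn0[of n] by simp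
    then have "?q \<in> Units K" using field_Units by blast
    then have i: "inv ?q \<in> carrier K" "?q \<otimes> inv ?q = \<one>" using q by auto
    then have i0: "inv ?q \<noteq> \<zero>" using q by (metis DiffE one_not_zero r_null)
    \<comment> \<open>With \<open>?q\<close> as its own denominator the value is the order of
      \<open>\<one>\<close> minus \<open>n\<close>.\<close>
    have "val (inv ?q) = k"
      using val_eq[OF i(1) i0, of ?q] i pD q nonpos by (simp add: ordp)
    then show ?thesis using i i0 by (metis DiffI image_eqI singletonD)
  qed
  then show "val ` (carrier K - {\<zero>}) = UNIV" by blast
qed (auto simp: val_times val_plus)

end

section \<open>Comparing the primes of all poles, and the family of their valuations\<close>

context noetherian_closed_subring
begin

abbreviation val_at :: "'a \<Rightarrow> 'a \<Rightarrow> int"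
  where "val_at x \<equiv> noetherian_closed_pole.val K D x"

lemma pole_locale: "prime_pole x \<Longrightarrow> noetherian_closed_pole K D x"
  by (intro noetherian_closed_pole.intro noetherian_closed_pole_axioms.intro)
    unfold_locales

text \<open>Take \<open>p\<close> with \<open>p y\<close> in \<open>D\<close> outside the larger
  prime and use \<open>(p y) a = (a y) p\<close>. If \<open>p\<close> is in the smaller prime, every
  \<open>a\<close> of the larger one is in it too. If not, \<open>y\<close> multiplies the smaller
  prime into itself, and closedness would put \<open>y\<close> into \<open>D\<close>.\<close>

lemma conductor_incomparable:
  assumes x: "prime_pole x" and y: "prime_pole y" and sub: "conductor x \<subseteq> conductor y"
  shows "conductor x = conductor y"
proof -
  interpret x: noetherian_closed_pole K D x using x by (rule pole_locale)
  interpret y: noetherian_closed_pole K D y using y by (rule pole_locale)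
  obtain p where p: "p \<in> conductor y" "p \<otimes> y \<in> D" "p \<otimes> y \<notin> conductor y"
    using y.uniformizer by blast
  have pD: "p \<in> D" using p by (simp add: conductor_def)
  interpret I: ideal "conductor x" "K\<lparr>carrier := D\<rparr>" by (rule conductor_ideal) simp
  have mult: "d \<otimes> a \<in> conductor x" if "a \<in> conductor x" "d \<in> D" for a d
    using I.I_l_closed[OF that(1)] that(2) by simp
  have swap: "(p \<otimes> y) \<otimes> a = (a \<otimes> y) \<otimes> p" if "a \<in> D" for a
    using pD that by (simp add: m_ac)
  show ?thesis
  proof (cases "p \<in> conductor x")
    case True
    have "a \<in> conductor x" if a: "a \<in> conductor y" for a
    proof -
      have aD: "a \<in> D" "a \<otimes> y \<in> D" using a by (auto simp: conductor_def)
      have "(p \<otimes> y) \<otimes> a \<in> conductor x" using mult[OF True aD(2)] swap[OF aD(1)] by simp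
      then show ?thesis using x.prime[OF p(2) aD(1)] p(3) sub by blast
    qed
    then show ?thesis using sub by blast
  next
    case False
    obtain c where c: "c \<in> D" "c \<noteq> \<zero>" "c \<otimes> x \<in> D" using fractions[OF x.x_closed] by blast
    have "c \<otimes> y [^] n \<in> conductor x" for n :: nat
    proof (induction n)
      case 0
      then show ?case using c by (simp add: conductor_def)
    next
      case (Suc n)
      let ?a = "c \<otimes> y [^] n"
      have a: "?a \<in> D" "?a \<otimes> y \<in> D" using Suc sub by (auto simp: conductor_def)
      have "(?a \<otimes> y) \<otimes> p \<in> conductor x" using mult[OF Suc p(2)] swap[OF a(1)] by simp
      then have "?a \<otimes> y \<in> conductor x" using x.prime[OF a(2) pD] False by blast
      then show ?case using c by (simp add: m_assoc)
    qed
    then have "y \<in> D" using closed[OF y.x_closed c(1,2)] by (auto simp: conductor_def)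
    then show ?thesis using y.x_notin by simp
  qed
qed

text \<open>For distinct conductors \<open>P\<^sub>0, P\<^sub>1, \<dots>\<close> of \<open>x\<^sub>0, x\<^sub>1, \<dots>\<close>, all containing \<open>y\<close>, the ideals
  \<open>I\<^sub>n = (y D : P\<^sub>0 \<inter> \<dots> \<inter> P\<^bsub>n-1\<^esub>)\<close> contain \<open>y x\<^sub>i\<close> for \<open>i < n\<close>. Once the chain is stationary,
  \<open>P\<^sub>0 \<inter> \<dots> \<inter> P\<^bsub>n-1\<^esub> \<subseteq> P\<^sub>n\<close>, contradicting primality and incomparability.\<close>

lemma finite_conductors:
  assumes y: "y \<in> D" "y \<noteq> \<zero>"
  shows "finite {P. y \<in> P \<and> (\<exists>x. prime_pole x \<and> P = conductor x)}"
proof (rule ccontr)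
  assume "infinite {P. y \<in> P \<and> (\<exists>x. prime_pole x \<and> P = conductor x)}"
  then obtain f :: "nat \<Rightarrow> 'a set" where f: "inj f"
    "range f \<subseteq> {P. y \<in> P \<and> (\<exists>x. prime_pole x \<and> P = conductor x)}"
    using infinite_countable_subset by blast
  then have "\<forall>i. \<exists>x. prime_pole x \<and> y \<in> conductor x \<and> f i = conductor x" by auto
  then obtain g where g: "\<And>i. prime_pole (g i)" "\<And>i. y \<in> conductor (g i)" "\<And>i. f i = conductor (g i)"
    by metis
  have gK: "g i \<in> carrier K" for i using g(1) by (simp add: prime_pole_def)
  define I where "I n = {z \<in> D. \<forall>w \<in> D. (\<forall>i<n. w \<in> conductor (g i)) \<longrightarrow> (\<exists>d \<in> D. w \<otimes> z = y \<otimes> d)}" for n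
  have "ideal (I n) (K\<lparr>carrier := D\<rparr>)" for n
  proof (rule D_ideal)
    show "\<zero> \<in> I n" using y by (auto simp: I_def intro!: bexI[of _ \<zero>])
    fix a b assume a: "a \<in> I n" and b: "b \<in> I n"
    show "a \<oplus> b \<in> I n"
      unfolding I_def
    proof (intro CollectI conjI ballI impI)
      fix w assume w: "w \<in> D" "\<forall>i<n. w \<in> conductor (g i)"
      then obtain d d' where "d \<in> D" "w \<otimes> a = y \<otimes> d" "d' \<in> D" "w \<otimes> b = y \<otimes> d'"
        using a b unfolding I_def by blast
      then show "\<exists>d\<in>D. w \<otimes> (a \<oplus> b) = y \<otimes> d"
        using a b w(1) y by (intro bexI[of _ "d \<oplus> d'"]) (auto simp: I_def r_distr)
    qed (use a b in \<open>auto simp: I_def\<close>)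
  next
    fix r a assume r: "r \<in> D" and a: "a \<in> I n"
    show "r \<otimes> a \<in> I n"
      unfolding I_def
    proof (intro CollectI conjI ballI impI)
      fix w assume w: "w \<in> D" "\<forall>i<n. w \<in> conductor (g i)"
      then obtain d where d: "d \<in> D" "w \<otimes> a = y \<otimes> d"
        using a unfolding I_def by blast
      have "w \<otimes> (r \<otimes> a) = r \<otimes> (w \<otimes> a)" using r w(1) a by (auto simp: I_def m_ac)
      also have "\<dots> = y \<otimes> (r \<otimes> d)" unfolding d(2) using d(1) r y by (simp add: m_ac)
      finally show "\<exists>d\<in>D. w \<otimes> (r \<otimes> a) = y \<otimes> d" using d r by blast
    qed (use r a in \<open>auto simp: I_def\<close>)
  qed (auto simp: I_def)
  moreover have "I n \<subseteq> I (Suc n)" for n by (auto simp: I_def)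
  ultimately obtain n where n: "I (Suc n) = I n"
    using noetherian_ring.ascending_chain_stabilizes[OF noetherian] by blast
  \<comment> \<open>For \<open>w\<close> in the conductor of \<open>g n\<close> the required
    quotient of \<open>w \<otimes> (y \<otimes> g n)\<close> by \<open>y\<close> is
    \<open>w \<otimes> g n\<close>.\<close>
  have "y \<otimes> g n \<in> I (Suc n)"
    unfolding I_def
  proof (intro CollectI conjI ballI impI)
    show "y \<otimes> g n \<in> D" using g(2) by (simp add: conductor_def)
    fix w assume w: "w \<in> D" "\<forall>i<Suc n. w \<in> conductor (g i)"
    then have "w \<otimes> g n \<in> D" by (auto simp: conductor_def)
    moreover have "w \<otimes> (y \<otimes> g n) = y \<otimes> (w \<otimes> g n)" using w(1) y(1) gK by (simp add: m_ac)
    ultimately show "\<exists>d\<in>D. w \<otimes> (y \<otimes> g n) = y \<otimes> d" by blast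
  qed
  then have yn: "y \<otimes> g n \<in> I n" by (simp only: n)
  have inter: "w \<in> conductor (g n)" if w: "w \<in> D" "\<forall>i<n. w \<in> conductor (g i)" for w
  proof -
    obtain d where d: "d \<in> D" "w \<otimes> (y \<otimes> g n) = y \<otimes> d" using yn w unfolding I_def by blast
    have "y \<otimes> (w \<otimes> g n) = y \<otimes> d" using d(2) w(1) y(1) gK by (simp add: m_ac)
    then have "w \<otimes> g n = d" using K_cancel[of y "w \<otimes> g n" d] y w(1) gK d(1) by simp
    then show ?thesis using w(1) d(1) by (simp add: conductor_def)
  qed
  interpret n: noetherian_closed_pole K D "g n" using g(1) by (rule pole_locale)
  \<comment> \<open>The element is a product of one factor from each earlier conductor, chosen
    outside that of \<open>g n\<close> by incomparability; primality keeps the product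
    outside.\<close>
  have "\<exists>w \<in> D. w \<notin> conductor (g n) \<and> (\<forall>i<m. w \<in> conductor (g i))" if "m \<le> n" for m
    using that
  proof (induction m)
    case 0
    then show ?case using n.one_notin by (intro bexI[of _ \<one>]) auto
  next
    case (Suc m)
    then obtain w where w: "w \<in> D" "w \<notin> conductor (g n)" "\<forall>i<m. w \<in> conductor (g i)" by auto
    have "f m \<noteq> f n" using f(1) Suc.prems by (simp add: inj_eq)
    then have "\<not> conductor (g m) \<subseteq> conductor (g n)"
      using conductor_incomparable[OF g(1) g(1)] g(3) by metis
    then obtain a where a: "a \<in> conductor (g m)" "a \<notin> conductor (g n)" by blast
    then have aD: "a \<in> D" by (simp add: conductor_def)
    have "w \<otimes> a \<in> conductor (g i)" if "i < Suc m" for i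
    proof (cases "i = m")
      case True
      then show ?thesis using a w(1) gK by (simp add: conductor_def m_assoc)
    next
      case False
      then have "w \<in> conductor (g i)" using w that by simp
      then have "w \<otimes> g i \<in> D" by (simp add: conductor_def)
      moreover have "(w \<otimes> a) \<otimes> g i = a \<otimes> (w \<otimes> g i)" using w(1) aD gK by (simp add: m_ac)
      ultimately show ?thesis using w(1) aD by (simp add: conductor_def)
    qed
    moreover have "w \<otimes> a \<notin> conductor (g n)" using n.prime w a(2) aD by blast
    ultimately show ?case using w(1) aD by blast
  qed
  then show False using inter by blast
qed

theorem discrete_valuations_exist:
  "\<exists>W. (\<forall>v \<in> W. discrete_valuation K v) \<and>
    D = {x \<in> carrier K. x = \<zero> \<or> (\<forall>v \<in> W. v x \<ge> 0)} \<and>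
    (\<forall>x \<in> carrier K - {\<zero>}. finite {v \<in> W. v x \<noteq> 0})"
proof -
  define \<P> where "\<P> = {P. \<exists>x. prime_pole x \<and> P = conductor x}"
  have "\<forall>P. \<exists>x. P \<in> \<P> \<longrightarrow> prime_pole x \<and> P = conductor x" by (auto simp: \<P>_def)
  \<comment> \<open>One pole per prime, so that it need not be shown that the valuation depends on the prime only.\<close>
  then obtain h where h: "\<And>P. P \<in> \<P> \<Longrightarrow> prime_pole (h P)" "\<And>P. P \<in> \<P> \<Longrightarrow> P = conductor (h P)"
    by metis
  define W where "W = (\<lambda>P. val_at (h P)) ` \<P>"
  have disc: "discrete_valuation K v" if "v \<in> W" for v
    using that h(1) noetherian_closed_pole.val_discrete[OF pole_locale] by (auto simp: W_def)
  have pos: "v z \<ge> 0" if "v \<in> W" "z \<in> D" "z \<noteq> \<zero>" for v z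
    using that h(1) noetherian_closed_pole.val_D[OF pole_locale] by (auto simp: W_def)
  \<comment> \<open>Some multiple \<open>r \<otimes> z\<close> is a prime pole. It has a negative
    value at its own prime while \<open>r\<close> has not, so \<open>z\<close> must have
    one.\<close>
  have neg: "\<exists>v \<in> W. v z < 0" if z: "z \<in> carrier K" "z \<notin> D" for z
  proof -
    obtain r where r: "r \<in> D" "prime_pole (r \<otimes> z)" using prime_pole_exists[OF z] by blast
    define P where "P = conductor (r \<otimes> z)"
    have P: "P \<in> \<P>" using r by (auto simp: P_def \<P>_def)
    interpret y: noetherian_closed_pole K D "r \<otimes> z" using r(2) by (rule pole_locale)
    \<comment> \<open>The pole chosen for \<open>P\<close> may differ from
      \<open>r \<otimes> z\<close>. The two share only the conductor, so the value is found through
      membership in \<open>P\<close>.\<close>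
    interpret x: noetherian_closed_pole K D "h P" using h(1)[OF P] by (rule pole_locale)
    have cx: "conductor (h P) = P" using h(2)[OF P] by simp
    obtain p where p: "p \<in> P" "p \<otimes> (r \<otimes> z) \<in> D" "p \<otimes> (r \<otimes> z) \<notin> P"
      using y.uniformizer by (auto simp: P_def)
    have pD: "p \<in> D" using p(1) by (simp add: P_def conductor_def)
    have zero: "\<zero> \<in> P" using z r by (auto simp: P_def conductor_def)
    have nz: "r \<otimes> z \<noteq> \<zero>" using y.x_notin by auto
    have p0: "p \<noteq> \<zero>" using p(3) zero nz by auto
    have r0: "r \<noteq> \<zero>" and z0: "z \<noteq> \<zero>" using nz r z by auto
    have u0: "p \<otimes> (r \<otimes> z) \<noteq> \<zero>" using p(3) zero by auto
    have "x.val (r \<otimes> z) = int (x.order (p \<otimes> (r \<otimes> z))) - int (x.order p)"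
      using x.val_eq[OF y.x_closed nz pD p0 p(2)] .
    moreover have "x.order (p \<otimes> (r \<otimes> z)) = 0" using x.order_eq_0_iff[OF p(2) u0] p(3) cx by simp
    moreover have "x.order p \<noteq> 0" using x.order_eq_0_iff[OF pD p0] p(1) cx by simp
    moreover have "x.val (r \<otimes> z) = x.val r + x.val z"
      using x.val_times[of r z] r(1) r0 z(1) z0 by simp
    moreover have "x.val r \<ge> 0" using x.val_D[OF r(1) r0] by simp
    ultimately have "x.val z < 0" by linarith
    then show ?thesis using P by (auto simp: W_def)
  qed
  have "finite {v \<in> W. v z \<noteq> 0}" if z: "z \<in> carrier K - {\<zero>}" for z
  proof -
    obtain s where s: "s \<in> D" "s \<noteq> \<zero>" "s \<otimes> z \<in> D" using fractions[of z] z by blast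
    have nz: "s \<otimes> z \<noteq> \<zero>" using s z integral_iff by auto
    have "{v \<in> W. v z \<noteq> 0} \<subseteq> (\<lambda>P. val_at (h P)) ` ({P. s \<in> P \<and> (\<exists>x. prime_pole x \<and> P = conductor x)}
      \<union> {P. s \<otimes> z \<in> P \<and> (\<exists>x. prime_pole x \<and> P = conductor x)})" (is "_ \<subseteq> _ ` ?S")
    proof
      fix v assume "v \<in> {v \<in> W. v z \<noteq> 0}"
      then obtain P where P: "P \<in> \<P>" "v = val_at (h P)" "v z \<noteq> 0" by (auto simp: W_def)
      interpret x: noetherian_closed_pole K D "h P" using h(1)[OF P(1)] by (rule pole_locale)
      \<comment> \<open>A non-zero value at \<open>z = (s z) / s\<close> needs a positive order of
        \<open>s z\<close> or of \<open>s\<close>, and each of these lies in finitely many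
        conductors.\<close>
      have "x.order (s \<otimes> z) \<noteq> 0 \<or> x.order s \<noteq> 0"
        using P(3) x.val_eq[OF _ _ s] z by (auto simp: P(2))
      then have "s \<otimes> z \<in> P \<or> s \<in> P"
        using x.order_eq_0_iff[OF s(1,2)] x.order_eq_0_iff[OF s(3) nz] h(2)[OF P(1)] by metis
      then have "P \<in> ?S" using P(1) by (auto simp: \<P>_def)
      then show "v \<in> (\<lambda>P. val_at (h P)) ` ?S" using P(2) by blast
    qed
    then show ?thesis
      using finite_conductors[OF s(1,2)] finite_conductors[OF s(3) nz] by (meson finite_UnI finite_imageI finite_subset)
  qed
  moreover have "D = {x \<in> carrier K. x = \<zero> \<or> (\<forall>v \<in> W. v x \<ge> 0)}"
    using pos neg by (force simp: not_le[symmetric])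
  ultimately show ?thesis using disc by blast
qed

end

section \<open>Connected rings\<close>

text \<open>Applied to the copy of a domain in its quotient field. Ideals are pulled back, their
  finite generating sets pushed forward.\<close>

lemma ring_hom_img_noetherian:
  assumes h: "h \<in> ring_hom R S" and R: "cring R" and S: "cring S" and noeth: "noetherian_ring R"
  shows "noetherian_ring (S\<lparr>carrier := h ` carrier R\<rparr>)"
proof -
  interpret R: cring R by fact
  interpret S: cring S by fact
  interpret hom: ring_hom_ring R S h using h by unfold_locales
  let ?B = "S\<lparr>carrier := h ` carrier R\<rparr>"
  interpret B: ring ?B using hom.img_is_ring .
  show ?thesis
  proof (rule B.noetherian_ringI)
    fix I assume I: "ideal I ?B"
    have pre: "ideal {a \<in> carrier R. h a \<in> J} R" if "ideal J ?B" for J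
    proof -
      interpret J: ideal J ?B by fact
      show ?thesis
      proof (rule R.ideal_criterion)
        show "\<zero>\<^bsub>R\<^esub> \<in> {a \<in> carrier R. h a \<in> J}" using J.zero_closed by simp
        fix x y assume "x \<in> {a \<in> carrier R. h a \<in> J}" "y \<in> {a \<in> carrier R. h a \<in> J}"
        then show "x \<oplus>\<^bsub>R\<^esub> y \<in> {a \<in> carrier R. h a \<in> J}" using J.a_closed[of "h x" "h y"] by simp
      next
        fix r x assume "r \<in> carrier R" "x \<in> {a \<in> carrier R. h a \<in> J}"
        then show "r \<otimes>\<^bsub>R\<^esub> x \<in> {a \<in> carrier R. h a \<in> J}" using J.I_l_closed[of "h x" "h r"] by simp
      qed auto
    qed
    obtain A where A: "A \<subseteq> carrier R" "finite A" "{a \<in> carrier R. h a \<in> I} = Idl\<^bsub>R\<^esub> A"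
      using noetherian_ring.finetely_gen[OF noeth pre[OF I]] by blast
    have hA: "h ` A \<subseteq> carrier ?B" using A(1) by auto
    have "h ` A \<subseteq> I" using R.genideal_self[OF A(1)] unfolding A(3)[symmetric] by blast
    then have "Idl\<^bsub>?B\<^esub> (h ` A) \<subseteq> I" using B.genideal_minimal[OF I] by blast
    moreover have "Idl\<^bsub>R\<^esub> A \<subseteq> {a \<in> carrier R. h a \<in> Idl\<^bsub>?B\<^esub> (h ` A)}"
      using R.genideal_minimal[OF pre[OF B.genideal_ideal[OF hA]]] B.genideal_self[OF hA] A(1) by blast
    then have "I \<subseteq> Idl\<^bsub>?B\<^esub> (h ` A)"
      unfolding A(3)[symmetric] using ideal.Icarr[OF I] by auto
    ultimately show "\<exists>A\<subseteq>carrier ?B. finite A \<and> I = Idl\<^bsub>?B\<^esub> A"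
      using hA A(2) by blast
  qed
qed

lemma (in domain) noetherian_completely_integrally_closed_krull:
  assumes noeth: "noetherian_ring R" and cic: "completely_integrally_closed R"
  shows "krull_domain R"
proof -
  let ?K = "total_quotient_ring R" and ?i = "to_total_quotient R"
  interpret K: field ?K by (rule tqr_field)
  have nc: "noetherian_closed_subring ?K (?i ` carrier R)"
  proof (intro noetherian_closed_subring.intro noetherian_closed_subring_axioms.intro)
    show "field ?K" by unfold_locales
    interpret hom: ring_hom_ring R ?K ?i using to_tqr_hom by unfold_locales
    show "subring (?i ` carrier R) ?K" using hom.img_is_subring[OF carrier_is_subring] .
    show "noetherian_ring (?K\<lparr>carrier := ?i ` carrier R\<rparr>)"
      using ring_hom_img_noetherian[OF to_tqr_hom is_cring tqr_cring noeth] .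
  next
    fix x assume "x \<in> carrier ?K"
    then obtain a s where "a \<in> carrier R" "s \<in> nonzerodivisors R" "x = fraction R a s"
      by (rule tqr_cases)
    then show "\<exists>s\<in>?i ` carrier R. s \<noteq> \<zero>\<^bsub>?K\<^esub> \<and> s \<otimes>\<^bsub>?K\<^esub> x \<in> ?i ` carrier R"
      using fraction_mult_denominator[of a s]
      by (intro bexI[of _ "?i s"])
        (auto simp: K.m_comm to_total_quotient_def tqr_eq_zero_iff nzd_eq)
  next
    fix x c assume x: "x \<in> carrier ?K" and c: "c \<in> ?i ` carrier R" "c \<noteq> \<zero>\<^bsub>?K\<^esub>"
      and h: "\<And>n::nat. c \<otimes>\<^bsub>?K\<^esub> x [^]\<^bsub>?K\<^esub> n \<in> ?i ` carrier R"
    obtain a s where a: "a \<in> carrier R" "s \<in> nonzerodivisors R" "x = fraction R a s"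
      using x by (rule tqr_cases)
    obtain d where d: "d \<in> carrier R" "c = ?i d" using c by blast
    then have d': "d \<in> nonzerodivisors R" using c by (auto simp: nzd_eq to_total_quotient_def tqr_zero)
    have "\<exists>r\<in>carrier R. d \<otimes> a [^] n = r \<otimes> s [^] n" for n :: nat
    proof -
      obtain r where r: "r \<in> carrier R" "c \<otimes>\<^bsub>?K\<^esub> x [^]\<^bsub>?K\<^esub> n = ?i r" using h[of n] by blast
      then have "d \<otimes> a [^] n = r \<otimes> s [^] n"
        using a d by (simp add: to_total_quotient_def tqr_pow tqr_mult fraction_eq_iff)
      with r show ?thesis by blast
    qed
    then obtain r where r: "r \<in> carrier R" "a = r \<otimes> s"
      using cic a d' unfolding completely_integrally_closed_def by meson
    then have "x = ?i r" using a by (simp add: to_total_quotient_def fraction_eq_iff)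
    with r show "x \<in> ?i ` carrier R" by blast
  qed
  show ?thesis
    unfolding krull_domain_def Let_def
    using noetherian_closed_subring.discrete_valuations_exist[OF nc] domain_axioms by blast
qed

section \<open>Regular and nilpotent elements in the absence of idempotents\<close>

context cring
begin

text \<open>Let \<open>d = p u + q v\<close> generate (p, q) in T(R), with
  \<open>p = (a / s) d\<close> and \<open>q = (b / s) d\<close>. Then \<open>(a / s) u\<close> kills
  \<open>q\<close>, its complement kills \<open>p\<close>, and their product is zero. The resulting
  idempotent of T(R) lies in \<open>R\<close>, so it is zero or one, which gives
  \<open>p = \<zero>\<close> or \<open>q = \<zero>\<close>.\<close>

lemma regular_or_nilpotent:
  assumes noeth: "noetherian_ring R" and gp: "generically_principal R"
    and cic: "completely_integrally_closed R"
    and connected: "\<And>e. \<lbrakk>e \<in> carrier R; e \<otimes> e = e\<rbrakk> \<Longrightarrow> e = \<zero> \<or> e = \<one>"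
    and x: "x \<in> carrier R"
  shows "x \<in> nonzerodivisors R \<or> (\<exists>n::nat. x [^] n = \<zero>)"
proof -
  define Ann where "Ann y = {z \<in> carrier R. y \<otimes> z = \<zero>}" for y
  have Ann: "ideal (Ann y) R" if "y \<in> carrier R" for y
    by (rule ideal_criterion) (use that in \<open>auto simp: Ann_def r_distr m_lcomm[of y]\<close>)
  have pow: "x [^] (k + n) = x [^] k \<otimes> x [^] n" for k n :: nat using x by (simp add: nat_pow_mult)
  have step: "Ann (x [^] n) \<subseteq> Ann (x [^] Suc n)" for n :: nat
    using x by (auto simp: Ann_def m_comm[of _ x] m_assoc)
  then obtain n where n: "Ann (x [^] Suc n) = Ann (x [^] n)"
    using noetherian_ring.ascending_chain_stabilizes[OF noeth, of "\<lambda>n. Ann (x [^] n)"] Ann x by auto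
  \<comment> \<open>One repetition in the chain of annihilators propagates to all higher
    powers.\<close>
  have stable: "Ann (x [^] (k + Suc n)) = Ann (x [^] Suc n)" for k :: nat
  proof (induction k)
    case (Suc k)
    have "z \<in> Ann (x [^] (k + Suc n))" if z: "z \<in> Ann (x [^] (Suc k + Suc n))" for z
    proof -
      have "x [^] (Suc k + Suc n) \<otimes> z = x [^] Suc n \<otimes> (x [^] Suc k \<otimes> z)"
        using z x pow[of "Suc k" "Suc n"] by (auto simp: Ann_def m_ac)
      then have "x [^] Suc k \<otimes> z \<in> Ann (x [^] Suc n)" using z x by (simp add: Ann_def)
      then have "x [^] Suc k \<otimes> z \<in> Ann (x [^] n)" using n by simp
      moreover have "x [^] n \<otimes> (x [^] Suc k \<otimes> z) = x [^] (k + Suc n) \<otimes> z"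
        using z x pow[of n "Suc k"] by (auto simp: Ann_def m_assoc add.commute)
      ultimately show ?thesis using z x by (simp add: Ann_def)
    qed
    then show ?case using Suc step[of "k + Suc n"] by auto
  qed simp
  \<comment> \<open>The exponent is positive, so that regularity of \<open>p\<close> will imply
    regularity of \<open>x\<close>.\<close>
  define p where "p = x [^] Suc n"
  have p: "p \<in> carrier R" using x by (simp add: p_def)
  have pp: "z \<in> Ann p" if z: "z \<in> carrier R" "p \<otimes> (p \<otimes> z) = \<zero>" for z
  proof -
    have "x [^] (Suc n + Suc n) \<otimes> z = p \<otimes> (p \<otimes> z)" using z(1) p pow by (simp only: p_def m_assoc)
    then have "z \<in> Ann (x [^] (Suc n + Suc n))" using z by (simp only: Ann_def mem_Collect_eq)
    then show ?thesis by (simp only: stable p_def)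
  qed
  obtain q where q: "q \<in> Ann p"
    "\<And>y. y \<in> Ann p \<Longrightarrow> \<exists>s\<in>nonzerodivisors R. \<exists>r\<in>carrier R. s \<otimes> y = r \<otimes> q"
    using gp Ann[OF p] unfolding generically_principal_def by metis
  have qc: "q \<in> carrier R" and pq: "p \<otimes> q = \<zero>" using q(1) by (auto simp: Ann_def)
  define I where "I = {p \<otimes> u \<oplus> q \<otimes> v | u v. u \<in> carrier R \<and> v \<in> carrier R}"
  have "ideal I R"
  proof (rule ideal_criterion)
    show "I \<subseteq> carrier R" using p qc by (auto simp: I_def)
    show "\<zero> \<in> I" using p qc by (auto simp: I_def intro!: exI[of _ \<zero>])
    fix y z assume "y \<in> I" "z \<in> I"
    then obtain u v u' v' where uv: "u \<in> carrier R" "v \<in> carrier R" "y = p \<otimes> u \<oplus> q \<otimes> v"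
      "u' \<in> carrier R" "v' \<in> carrier R" "z = p \<otimes> u' \<oplus> q \<otimes> v'" by (auto simp: I_def)
    then have "y \<oplus> z = p \<otimes> (u \<oplus> u') \<oplus> q \<otimes> (v \<oplus> v')" using p qc by (simp add: r_distr a_ac)
    then show "y \<oplus> z \<in> I" using uv unfolding I_def by blast
  next
    fix r z assume "r \<in> carrier R" "z \<in> I"
    then obtain u v where uv: "r \<in> carrier R" "u \<in> carrier R" "v \<in> carrier R" "z = p \<otimes> u \<oplus> q \<otimes> v"
      by (auto simp: I_def)
    then have "r \<otimes> z = p \<otimes> (r \<otimes> u) \<oplus> q \<otimes> (r \<otimes> v)" using p qc by (simp add: r_distr m_lcomm)
    then show "r \<otimes> z \<in> I" using uv unfolding I_def by blast
  qed
  then obtain d where d: "d \<in> I"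
    "\<And>y. y \<in> I \<Longrightarrow> \<exists>s\<in>nonzerodivisors R. \<exists>r\<in>carrier R. s \<otimes> y = r \<otimes> d"
    using gp unfolding generically_principal_def by metis
  obtain u v where uv: "u \<in> carrier R" "v \<in> carrier R" "d = p \<otimes> u \<oplus> q \<otimes> v" using d(1) by (auto simp: I_def)
  have dc: "d \<in> carrier R" using uv p qc by simp
  have pI: "p \<in> I" unfolding I_def using p qc by (intro CollectI exI[of _ \<one>] exI[of _ \<zero>]) simp
  have qI: "q \<in> I" unfolding I_def using p qc by (intro CollectI exI[of _ \<zero>] exI[of _ \<one>]) simp
  obtain s1 a1 where a1: "s1 \<in> nonzerodivisors R" "a1 \<in> carrier R" "s1 \<otimes> p = a1 \<otimes> d" using d(2)[OF pI] by blast
  obtain s2 b1 where b1: "s2 \<in> nonzerodivisors R" "b1 \<in> carrier R" "s2 \<otimes> q = b1 \<otimes> d" using d(2)[OF qI] by blast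
  \<comment> \<open>A common denominator for the two multipliers of \<open>d\<close>.\<close>
  define s a b where "s = s1 \<otimes> s2" and "a = s2 \<otimes> a1" and "b = s1 \<otimes> b1"
  have s: "s \<in> nonzerodivisors R" and c: "s \<in> carrier R" "a \<in> carrier R" "b \<in> carrier R"
    using a1 b1 by (auto simp: s_def a_def b_def)
  have sp: "s \<otimes> p = a \<otimes> d"
  proof -
    have "s \<otimes> p = s2 \<otimes> (s1 \<otimes> p)" using a1(1,2) b1(1,2) p by (simp add: s_def m_ac)
    then show ?thesis unfolding a1(3) using a1(1,2) b1(1,2) dc by (simp add: a_def m_assoc)
  qed
  have sq: "s \<otimes> q = b \<otimes> d"
  proof -
    have "s \<otimes> q = s1 \<otimes> (s2 \<otimes> q)" using a1(1,2) b1(1,2) qc by (simp add: s_def m_ac)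
    then show ?thesis unfolding b1(3) using a1(1,2) b1(1,2) dc by (simp add: b_def m_assoc)
  qed
  have aqbp: "a \<otimes> q = b \<otimes> p"
  proof (rule nzd_cancel[OF s])
    have "s \<otimes> (a \<otimes> q) = a \<otimes> (s \<otimes> q)" using c qc by (simp add: m_ac)
    also have "\<dots> = b \<otimes> (a \<otimes> d)" unfolding sq using c dc by (simp add: m_ac)
    also have "\<dots> = s \<otimes> (b \<otimes> p)" unfolding sp[symmetric] using c p by (simp add: m_ac)
    finally show "s \<otimes> (a \<otimes> q) = s \<otimes> (b \<otimes> p)" .
  qed (use c p qc in auto)
  \<comment> \<open>Since \<open>b p = a q\<close>, two factors \<open>p\<close> kill
    \<open>b\<close>; the stable annihilator reduces this to one.\<close>
  have "p \<otimes> (p \<otimes> b) = a \<otimes> (p \<otimes> q)"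
  proof -
    have "p \<otimes> (p \<otimes> b) = p \<otimes> (b \<otimes> p)" using c p by (simp add: m_comm)
    also have "\<dots> = a \<otimes> (p \<otimes> q)" unfolding aqbp[symmetric] using c p qc by (simp add: m_lcomm)
    finally show ?thesis .
  qed
  then have "p \<otimes> (p \<otimes> b) = \<zero>" using pq c by simp
  then have pb: "p \<otimes> b = \<zero>" using pp c by (simp add: Ann_def)
  then have aq: "a \<otimes> q = \<zero>" using aqbp c p by (simp add: m_comm)
  \<comment> \<open>\<open>t1 / s\<close> is an idempotent of the total quotient ring.\<close>
  define t1 where "t1 = a \<otimes> u"
  define t2 where "t2 = s \<ominus> t1"
  have tc: "t1 \<in> carrier R" "t2 \<in> carrier R" using c uv by (auto simp: t1_def t2_def)
  have st: "s = t1 \<oplus> t2" using tc c by (simp add: t2_def a_minus_def a_lcomm[of t1] r_neg)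
  have t1q: "t1 \<otimes> q = \<zero>"
  proof -
    have "t1 \<otimes> q = u \<otimes> (a \<otimes> q)" using c uv qc by (simp add: t1_def m_ac)
    then show ?thesis using aq uv by simp
  qed
  have t2p: "p \<otimes> t2 = \<zero>"
  proof (rule nzd_zero[OF s])
    \<comment> \<open>Substituting the multiples of \<open>d\<close> for \<open>p\<close> and
      \<open>q\<close> in \<open>d = p u + q v\<close>: the element \<open>(a u + b v) / s\<close>
      acts as the identity on \<open>d\<close>.\<close>
    have dsp: "d \<otimes> (s \<ominus> (t1 \<oplus> b \<otimes> v)) = \<zero>"
    proof -
      have "s \<otimes> d = (s \<otimes> p) \<otimes> u \<oplus> (s \<otimes> q) \<otimes> v" using c p qc uv by (simp add: uv(3) r_distr m_assoc)
      also have "\<dots> = d \<otimes> (t1 \<oplus> b \<otimes> v)" unfolding sp sq using c dc uv(1,2) by (simp add: t1_def r_distr m_ac)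
      finally have "d \<otimes> s = d \<otimes> (t1 \<oplus> b \<otimes> v)" using c dc by (simp add: m_comm)
      then show ?thesis using c dc tc uv(1,2) by (simp add: a_minus_def r_distr[of s] r_minus r_neg)
    qed
    have "s \<otimes> (p \<otimes> t2) = a \<otimes> (d \<otimes> (s \<ominus> t1))"
    proof -
      have "s \<otimes> (p \<otimes> t2) = (s \<otimes> p) \<otimes> t2" using c p tc by (simp add: m_assoc)
      then show ?thesis unfolding sp t2_def using c dc tc by (simp add: m_assoc)
    qed
    also have "s \<ominus> t1 = (s \<ominus> (t1 \<oplus> b \<otimes> v)) \<oplus> b \<otimes> v"
      using c tc uv by (simp add: a_minus_def minus_add a_assoc l_neg)
    also have "a \<otimes> (d \<otimes> \<dots>) = a \<otimes> (d \<otimes> (s \<ominus> (t1 \<oplus> b \<otimes> v))) \<oplus> (a \<otimes> d) \<otimes> (b \<otimes> v)"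
      using c tc uv(1,2) dc by (simp add: r_distr m_assoc)
    also have "\<dots> = (s \<otimes> p) \<otimes> (b \<otimes> v)" unfolding dsp sp[symmetric] using c p uv by simp
    also have "\<dots> = s \<otimes> ((p \<otimes> b) \<otimes> v)" using c p uv by (simp add: m_assoc)
    finally show "s \<otimes> (p \<otimes> t2) = \<zero>" using pb c uv by simp
  qed (use p tc in simp)
  \<comment> \<open>\<open>t2\<close> annihilates \<open>p\<close>, hence is a fractional multiple
    of \<open>q\<close>, and \<open>t1\<close> kills \<open>q\<close>.\<close>
  then obtain \<sigma> r where \<sigma>: "\<sigma> \<in> nonzerodivisors R" "r \<in> carrier R" "\<sigma> \<otimes> t2 = r \<otimes> q"
    using q(2)[of t2] tc by (auto simp: Ann_def)
  have t12: "t1 \<otimes> t2 = \<zero>"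
  proof (rule nzd_zero[OF \<sigma>(1)])
    have "\<sigma> \<otimes> (t1 \<otimes> t2) = t1 \<otimes> (\<sigma> \<otimes> t2)" using \<sigma>(1) tc by (simp add: m_lcomm)
    also have "\<dots> = r \<otimes> (t1 \<otimes> q)" unfolding \<sigma>(3) using \<sigma>(2) tc qc by (simp add: m_lcomm)
    finally show "\<sigma> \<otimes> (t1 \<otimes> t2) = \<zero>" using t1q \<sigma>(2) by simp
  qed (use tc in simp)
  have t1s: "t1 \<otimes> t1 = t1 \<otimes> s" using tc t12 by (simp add: st r_distr)
  \<comment> \<open>Positive powers of the idempotent \<open>t1 / s\<close> equal
    \<open>t1 / s\<close>, so \<open>s\<close> is a common denominator of all powers.\<close>
  have "\<exists>r\<in>carrier R. t1 = r \<otimes> s"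
  proof -
    have "t1 [^] Suc n = t1 \<otimes> s [^] n" for n :: nat
    proof (induction n)
      case (Suc n)
      have "t1 [^] Suc (Suc n) = (t1 \<otimes> s [^] n) \<otimes> t1" using Suc by simp
      also have "\<dots> = s [^] n \<otimes> (t1 \<otimes> t1)" using tc c by (simp add: m_ac)
      also have "\<dots> = t1 \<otimes> s [^] Suc n" unfolding t1s using tc c by (simp add: m_ac)
      finally show ?case .
    qed (use tc in simp)
    then have "s \<otimes> t1 [^] Suc n = t1 \<otimes> s [^] Suc n" for n :: nat using tc c by (simp add: m_ac)
    then have "\<exists>r\<in>carrier R. s \<otimes> t1 [^] n = r \<otimes> s [^] n" for n :: nat
      using tc c by (cases n) (auto intro: bexI[of _ s] bexI[of _ t1])
    then show ?thesis using cic s tc unfolding completely_integrally_closed_def by meson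
  qed
  then obtain e where e: "e \<in> carrier R" "t1 = e \<otimes> s" by blast
  have "e \<otimes> e = e"
  proof (rule nzd_cancel[OF nzd_mult[OF s s]])
    have "(s \<otimes> s) \<otimes> (e \<otimes> e) = t1 \<otimes> t1" using e c by (simp add: e(2) m_ac)
    also have "\<dots> = (s \<otimes> s) \<otimes> e" unfolding t1s using e c by (simp add: e(2) m_ac)
    finally show "(s \<otimes> s) \<otimes> (e \<otimes> e) = (s \<otimes> s) \<otimes> e" .
  qed (use e in auto)
  with connected e consider "e = \<zero>" | "e = \<one>" by blast
  then show ?thesis
  proof cases
    case 1
    then have "t2 = s" using e c tc st by simp
    then have "s \<otimes> p = \<zero>" using t2p p c by (simp add: m_comm)
    then have "p = \<zero>" using nzd_zero[OF s p] by simp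
    then show ?thesis unfolding p_def by blast
  next
    case 2
    then have "s \<otimes> q = \<zero>" using e c t1q by simp
    then have q0: "q = \<zero>" using nzd_zero[OF s qc] by simp
    have "p \<in> nonzerodivisors R"
    proof (rule nzdI[OF p])
      fix y assume "y \<in> carrier R" "p \<otimes> y = \<zero>"
      moreover from this obtain \<sigma> r where "\<sigma> \<in> nonzerodivisors R" "r \<in> carrier R" "\<sigma> \<otimes> y = r \<otimes> q"
        using q(2)[of y] by (auto simp: Ann_def)
      ultimately show "y = \<zero>" using q0 nzd_zero[of \<sigma> y] by simp
    qed
    then show ?thesis using nzd_of_pow x unfolding p_def by blast
  qed
qed

end

section \<open>The two kinds of connected factors\<close>

context cring
begin

lemma no_nilpotents_imp_domain:
  assumes "\<And>x. x \<in> carrier R \<Longrightarrow> x \<in> nonzerodivisors R \<or> x = \<zero>" and "\<one> \<noteq> \<zero>"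
  shows "domain R"
proof (rule domainI)
  show "cring R" by (rule is_cring)
  fix a b assume "a \<otimes> b = \<zero>" "a \<in> carrier R" "b \<in> carrier R"
  then show "a = \<zero> \<or> b = \<zero>" using assms(1)[of a] nzd_zero[of a b] by blast
qed (rule assms)

text \<open>Dividing a non-zero nilpotent repeatedly by a regular \<open>s\<close> yields an
  ascending chain of principal ideals. Where it repeats, some \<open>1 - r s\<close> kills a
  non-zero element, so it is nilpotent and \<open>s\<close> is a unit. The nilpotents are then all
  the non-units, and fractional generation of their ideal is true generation.\<close>

lemma nilpotents_imp_special_primary:
  assumes noeth: "noetherian_ring R" and gp: "generically_principal R"
    and cic: "completely_integrally_closed R"
    and dich: "\<And>x. x \<in> carrier R \<Longrightarrow> x \<in> nonzerodivisors R \<or> (\<exists>n::nat. x [^] n = \<zero>)"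
    and \<pi>: "\<pi> \<in> carrier R" "\<pi> \<noteq> \<zero>" "\<exists>n::nat. \<pi> [^] n = \<zero>"
  shows "special_primary_ring R"
proof -
  have one: "\<one> \<noteq> \<zero>" using \<pi> one_zeroD by blast
  have nil_not_nzd: "x \<notin> nonzerodivisors R" if "x [^] (n::nat) = \<zero>" for x n
  proof
    assume "x \<in> nonzerodivisors R"
    then have "\<zero> \<in> nonzerodivisors R" using nzd_pow[of x n] that by simp
    then show False using nzd_zero[of \<zero> \<one>] one by simp
  qed
  define N where "N = {x \<in> carrier R. \<exists>n::nat. x [^] n = \<zero>}"
  have N_iff: "x \<in> N \<longleftrightarrow> x \<notin> nonzerodivisors R" if "x \<in> carrier R" for x
    using that dich nil_not_nzd by (auto simp: N_def)
  \<comment> \<open>From \<open>s z = - x z\<close> it follows that \<open>s^k z\<close> is a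
    multiple of \<open>x^k z\<close>, which vanishes for large \<open>k\<close>.\<close>
  have reg_add: "s \<oplus> x \<in> nonzerodivisors R" if s: "s \<in> nonzerodivisors R" and x: "x \<in> N" for s x
  proof (rule nzdI)
    have xc: "x \<in> carrier R" using x by (simp add: N_def)
    then show "s \<oplus> x \<in> carrier R" using s by simp
    fix z assume z: "z \<in> carrier R" "(s \<oplus> x) \<otimes> z = \<zero>"
    obtain n :: nat where n: "x [^] n = \<zero>" using x by (auto simp: N_def)
    have "s \<otimes> z \<oplus> x \<otimes> z = \<zero>" using z xc s by (simp add: l_distr)
    then have sz: "s \<otimes> z = (\<ominus> \<one>) \<otimes> (x \<otimes> z)" using z(1) xc s by (simp add: sum_zero_eq_neg l_minus)
    have "\<exists>r \<in> carrier R. s [^] k \<otimes> z = r \<otimes> (x [^] k \<otimes> z)" for k :: nat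
    proof (induction k)
      case 0
      show ?case using z by (intro bexI[of _ \<one>]) auto
    next
      case (Suc k)
      then obtain r where r: "r \<in> carrier R" "s [^] k \<otimes> z = r \<otimes> (x [^] k \<otimes> z)" by blast
      have "s [^] Suc k \<otimes> z = s \<otimes> (s [^] k \<otimes> z)" using s z(1) by (simp add: m_ac)
      also have "\<dots> = (r \<otimes> x [^] k) \<otimes> (s \<otimes> z)" unfolding r(2) using r(1) s z(1) xc by (simp add: m_ac)
      also have "\<dots> = (\<ominus> \<one> \<otimes> r) \<otimes> (x [^] Suc k \<otimes> z)" unfolding sz using r(1) xc z(1) by (simp add: m_ac l_minus r_minus)
      finally show ?case using r(1) by (intro bexI[of _ "\<ominus> \<one> \<otimes> r"]) auto
    qed
    from this[of n] have "s [^] n \<otimes> z = \<zero>" using n z(1) by auto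
    then show "z = \<zero>" using nzd_zero[of "s [^] n" z] s z(1) by simp
  qed
  have N_ideal: "ideal N R"
  proof (rule ideal_criterion)
    show "\<zero> \<in> N" by (auto simp: N_def intro: exI[of _ "Suc 0"])
  next
    fix x y assume xy: "x \<in> N" "y \<in> N"
    then have c: "x \<in> carrier R" "y \<in> carrier R" by (auto simp: N_def)
    have my: "(\<ominus> \<one>) \<otimes> y \<in> N"
    proof -
      obtain n :: nat where "y [^] n = \<zero>" using xy by (auto simp: N_def)
      then have "((\<ominus> \<one>) \<otimes> y) [^] n = \<zero>" using c nat_pow_distrib[of "\<ominus> \<one>" y n] by simp
      moreover have "(\<ominus> \<one>) \<otimes> y \<in> carrier R" using c by simp
      ultimately show ?thesis unfolding N_def by blast
    qed
    \<comment> \<open>Otherwise \<open>x\<close>, as the sum of the regular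
      \<open>x \<oplus> y\<close> and the nilpotent \<open>- y\<close>, would be regular.\<close>
    have "x \<oplus> y \<notin> nonzerodivisors R"
    proof
      assume "x \<oplus> y \<in> nonzerodivisors R"
      from reg_add[OF this my] have "x \<in> nonzerodivisors R"
        using c by (simp add: l_minus a_assoc r_neg)
      then show False using N_iff xy c by blast
    qed
    then show "x \<oplus> y \<in> N" using N_iff c by simp
  next
    fix r x assume r: "r \<in> carrier R" and x: "x \<in> N"
    then obtain n :: nat where "x [^] n = \<zero>" by (auto simp: N_def)
    then have "(r \<otimes> x) [^] n = \<zero>" using r x nat_pow_distrib[of r x n] by (simp add: N_def)
    moreover have "r \<otimes> x \<in> carrier R" using r x by (simp add: N_def)
    ultimately show "r \<otimes> x \<in> N" unfolding N_def by blast
  qed (auto simp: N_def)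
  \<comment> \<open>\<open>s^n\<close> is a common denominator of the powers of
    \<open>x / s\<close>: it clears those up to \<open>n\<close>, and the others vanish.\<close>
  have divide: "\<exists>y. y \<in> N \<and> x = y \<otimes> s" if x: "x \<in> N" and s: "s \<in> nonzerodivisors R" for x s
  proof -
    obtain n :: nat where n: "x [^] n = \<zero>" "x \<in> carrier R" using x by (auto simp: N_def)
    have "\<exists>r\<in>carrier R. s [^] n \<otimes> x [^] k = r \<otimes> s [^] k" for k :: nat
    proof (cases "k \<le> n")
      case True
      then have "s [^] n = s [^] (n - k) \<otimes> s [^] k" using s by (simp add: nat_pow_mult)
      then have "s [^] n \<otimes> x [^] k = (s [^] (n - k) \<otimes> x [^] k) \<otimes> s [^] k" using s n by (simp add: m_ac)
      then show ?thesis using s n(2) by (intro bexI[of _ "s [^] (n - k) \<otimes> x [^] k"]) auto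
    next
      case False
      then have "x [^] k = x [^] n \<otimes> x [^] (k - n)" using n(2) by (simp add: nat_pow_mult)
      then have "x [^] k = \<zero>" using n by simp
      then show ?thesis using s by (intro bexI[of _ \<zero>]) auto
    qed
    then obtain y where y: "y \<in> carrier R" "x = y \<otimes> s"
      using cic n(2) s nzd_pow[OF s, of n] unfolding completely_integrally_closed_def by meson
    have "y [^] n \<otimes> s [^] n = \<zero>" using n(1) y s by (simp add: nat_pow_distrib)
    then have "y [^] n = \<zero>" using nzd_zero[of "s [^] n" "y [^] n"] s y by (simp add: m_comm)
    then show ?thesis using y by (auto simp: N_def)
  qed
  have unit: "\<exists>k \<in> carrier R. k \<otimes> s = \<one>" if s: "s \<in> nonzerodivisors R" for s
  proof -
    have "\<pi> \<in> N" using \<pi> by (simp add: N_def)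
    have "\<exists>g. \<forall>n::nat. (g n \<in> N \<and> g n \<noteq> \<zero>) \<and> g n = g (Suc n) \<otimes> s"
    proof (rule dependent_nat_choice)
      show "\<exists>x. x \<in> N \<and> x \<noteq> \<zero>" using \<open>\<pi> \<in> N\<close> \<pi>(2) by blast
      fix x assume x: "x \<in> N \<and> x \<noteq> \<zero>"
      then obtain y where "y \<in> N" "x = y \<otimes> s" using divide s by blast
      then show "\<exists>y. (y \<in> N \<and> y \<noteq> \<zero>) \<and> x = y \<otimes> s" using x s by auto
    qed
    then obtain g where g: "\<And>n::nat. g n \<in> N" "\<And>n. g n \<noteq> \<zero>" "\<And>n. g n = g (Suc n) \<otimes> s" by blast
    have gc: "g n \<in> carrier R" for n using g(1) by (simp add: N_def)
    have "PIdl (g n) \<subseteq> PIdl (g (Suc n))" for n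
    proof (rule cgenideal_minimal[OF cgenideal_ideal[OF gc]])
      show "g n \<in> PIdl (g (Suc n))"
        using g(3)[of n] s gc[of "Suc n"] by (auto simp: cgenideal_def m_comm)
    qed
    then obtain n where n: "PIdl (g (Suc n)) = PIdl (g n)"
      using noetherian_ring.ascending_chain_stabilizes[OF noeth, of "\<lambda>n. PIdl (g n)"] cgenideal_ideal gc by metis
    have "g (Suc n) \<in> PIdl (g n)" using cgenideal_self[OF gc[of "Suc n"]] n by simp
    then obtain r where r: "r \<in> carrier R" "g (Suc n) = r \<otimes> g n" by (auto simp: cgenideal_def)
    define m where "m = \<one> \<ominus> r \<otimes> s"
    have mc: "m \<in> carrier R" using r s by (simp add: m_def)
    have "(r \<otimes> s) \<otimes> g (Suc n) = g (Suc n)"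
    proof -
      have "(r \<otimes> s) \<otimes> g (Suc n) = r \<otimes> (g (Suc n) \<otimes> s)" using r(1) s gc[of "Suc n"] by (simp add: m_ac)
      then show ?thesis by (simp only: g(3)[symmetric] r(2)[symmetric])
    qed
    then have "m \<otimes> g (Suc n) = \<zero>"
      using r(1) s gc[of "Suc n"] by (simp add: m_def a_minus_def l_distr l_minus r_neg)
    then have "m \<notin> nonzerodivisors R" using nzd_zero[of m "g (Suc n)"] gc g(2) by blast
    then obtain k :: nat where "m [^] k = \<zero>" using dich mc by blast
    then obtain k where k: "k \<in> carrier R" "k \<otimes> (\<one> \<ominus> m) = \<one>" using one_minus_nilpotent_unit[OF mc] by blast
    have "\<one> \<ominus> m = r \<otimes> s"
      using r(1) s by (simp add: m_def a_minus_def minus_add a_assoc[symmetric] r_neg)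
    then show ?thesis using k r(1) s by (intro bexI[of _ "k \<otimes> r"]) (auto simp: m_assoc)
  qed
  obtain a where a: "a \<in> N" "\<And>x. x \<in> N \<Longrightarrow> \<exists>s\<in>nonzerodivisors R. \<exists>r\<in>carrier R. s \<otimes> x = r \<otimes> a"
    using gp N_ideal unfolding generically_principal_def by metis
  have ac: "a \<in> carrier R" using a(1) by (simp add: N_def)
  have N_gen: "N = PIdl a"
  proof
    show "PIdl a \<subseteq> N" using cgenideal_minimal[OF N_ideal a(1)] .
    show "N \<subseteq> PIdl a"
    proof
      fix x assume x: "x \<in> N"
      then have xc: "x \<in> carrier R" by (simp add: N_def)
      obtain s r where s: "s \<in> nonzerodivisors R" "r \<in> carrier R" "s \<otimes> x = r \<otimes> a" using a(2)[OF x] by blast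
      obtain k where k: "k \<in> carrier R" "k \<otimes> s = \<one>" using unit[OF s(1)] by blast
      have "x = (k \<otimes> s) \<otimes> x" using k xc by simp
      also have "\<dots> = k \<otimes> (s \<otimes> x)" using k(1) s(1) xc by (simp add: m_assoc)
      also have "\<dots> = (k \<otimes> r) \<otimes> a" unfolding s(3) using k(1) s(2) ac by (simp add: m_assoc)
      finally show "x \<in> PIdl a" using k(1) s(2) unfolding cgenideal_def by blast
    qed
  qed
  obtain n :: nat where n: "a [^] n = \<zero>" using a(1) by (auto simp: N_def)
  then have n1: "n \<ge> 1" using one by (cases n) auto
  have proper_sub: "I \<subseteq> N" if I: "ideal I R" "I \<noteq> carrier R" for I
  proof
    fix x assume x: "x \<in> I"
    then have xc: "x \<in> carrier R" using ideal.Icarr[OF I(1)] by blast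
    show "x \<in> N"
    proof (rule ccontr)
      assume "x \<notin> N"
      then obtain k where "k \<in> carrier R" "k \<otimes> x = \<one>" using unit N_iff xc by blast
      then have "\<one> \<in> I" using ideal.I_l_closed[OF I(1) x] by metis
      then show False using ideal.one_imp_carrier[OF I(1)] I(2) by blast
    qed
  qed
  have N_proper: "N \<noteq> carrier R"
    using N_iff[of \<one>] by auto
  have max: "maximalideal N R"
  proof (rule maximalidealI[OF N_ideal])
    show "carrier R \<noteq> N" using N_proper by simp
    fix J assume "ideal J R" "N \<subseteq> J" "J \<subseteq> carrier R"
    then show "J = N \<or> J = carrier R" using proper_sub by blast
  qed
  moreover have "M' = N" if "maximalideal M' R" for M'
  proof -
    interpret M': maximalideal M' R by fact
    have "M' \<subseteq> N" using proper_sub[OF M'.is_ideal] M'.I_notcarr by simp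
    then show ?thesis using M'.I_maximal[OF N_ideal] N_proper by (auto simp: N_def)
  qed
  moreover have "principalideal N R"
    using N_ideal ac N_gen by (intro principalidealI) (auto simp: cgenideal_eq_genideal)
  moreover have "N [^]\<^bsub>ideals_set R\<^esub> n = {\<zero>}"
  proof -
    \<comment> \<open>Only the inclusion into the principal ideal of \<open>a [^] k\<close> is
      proved by induction; being an ideal provides the zero for equality at
      \<open>k = n\<close>.\<close>
    have pow: "ideal (N [^]\<^bsub>ideals_set R\<^esub> k) R \<and> N [^]\<^bsub>ideals_set R\<^esub> k \<subseteq> PIdl (a [^] k)" for k :: nat
    proof (induction k)
      case 0
      show ?case using oneideal by (auto simp: ideals_set_def cgenideal_def) (metis r_one)
    next
      case (Suc k)
      have eq: "N [^]\<^bsub>ideals_set R\<^esub> Suc k = (N [^]\<^bsub>ideals_set R\<^esub> k) \<cdot> N"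
        by (simp add: ideals_set_def)
      have P: "additive_subgroup (PIdl (a [^] Suc k)) R"
        using cgenideal_ideal ac by (intro ideal.axioms(1)) simp
      have "x \<in> PIdl (a [^] Suc k)" if "x \<in> (N [^]\<^bsub>ideals_set R\<^esub> k) \<cdot> N" for x
        using that
      proof (induction rule: ideal_prod.induct)
        case (prod i j)
        have "i \<in> PIdl (a [^] k)" using prod(1) Suc by (meson subsetD)
        moreover have "j \<in> PIdl a" using prod(2) by (simp only: N_gen)
        ultimately obtain r t where rt: "r \<in> carrier R" "t \<in> carrier R"
          "i = r \<otimes> a [^] k" "j = t \<otimes> a"
          unfolding cgenideal_def by blast
        have "i \<otimes> j = (r \<otimes> t) \<otimes> a [^] Suc k"
          unfolding rt(3,4) using rt(1,2) ac by (simp add: m_ac)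
        moreover have "r \<otimes> t \<in> carrier R" using rt(1,2) by simp
        ultimately show ?case unfolding cgenideal_def by blast
      qed (rule additive_subgroup.a_closed[OF P])
      then show ?case using ideal_prod_is_ideal[OF _ N_ideal] Suc unfolding eq by blast
    qed
    have "PIdl (a [^] n) = {\<zero>}"
      using cgenideal_eq_genideal[OF zero_closed] genideal_zero n by simp
    then show ?thesis using pow[of n] additive_subgroup.zero_closed[OF ideal.axioms(1)] by fastforce
  qed
  ultimately show ?thesis
    using n1 by (intro special_primary_ring.intro special_primary_ring_axioms.intro is_cring) blast
qed

lemma connected_krull_or_special_primary:
  assumes noeth: "noetherian_ring R" and gp: "generically_principal R"
    and cic: "completely_integrally_closed R"
    and connected: "\<And>e. \<lbrakk>e \<in> carrier R; e \<otimes> e = e\<rbrakk> \<Longrightarrow> e = \<zero> \<or> e = \<one>"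
    and one: "\<one> \<noteq> \<zero>"
  shows "krull_domain R \<or> special_primary_ring R"
proof -
  note dich = regular_or_nilpotent[OF noeth gp cic connected]
  show ?thesis
  proof (cases "\<exists>x \<in> carrier R. x \<noteq> \<zero> \<and> (\<exists>n::nat. x [^] n = \<zero>)")
    case True
    then show ?thesis using nilpotents_imp_special_primary[OF noeth gp cic dich] by blast
  next
    case False
    then have "domain R" using dich one by (intro no_nilpotents_imp_domain) blast+
    then show ?thesis
      using domain.noetherian_completely_integrally_closed_krull[OF _ noeth cic] by blast
  qed
qed

section \<open>Splitting the ring into connected corners\<close>

definition decomposable :: "'a \<Rightarrow> bool"
  where "decomposable e \<longleftrightarrow> (\<exists>Rs :: 'a ring list. Rs \<noteq> [] \<and>
    (\<forall>S \<in> set Rs. krull_domain S \<or> special_primary_ring S) \<and> corner R e \<simeq> RDirProd_list Rs)"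

lemma decomposable_add:
  assumes g: "g \<in> carrier R" "g \<otimes> g = g" and h: "h \<in> carrier R" "h \<otimes> h = h" and gh: "g \<otimes> h = \<zero>"
    and dec: "decomposable g" "decomposable h"
  shows "decomposable (g \<oplus> h)"
proof -
  obtain Rs Ss :: "'a ring list" where Rs: "Rs \<noteq> []" "\<forall>S \<in> set Rs. krull_domain S \<or> special_primary_ring S"
      "corner R g \<simeq> RDirProd_list Rs"
    and Ss: "\<forall>S \<in> set Ss. krull_domain S \<or> special_primary_ring S" "corner R h \<simeq> RDirProd_list Ss"
    using dec unfolding decomposable_def by blast
  obtain \<phi> \<psi> \<chi> where "\<phi> \<in> ring_iso (corner R g) (RDirProd_list Rs)"
    "\<psi> \<in> ring_iso (corner R h) (RDirProd_list Ss)"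
    "\<chi> \<in> ring_iso (RDirProd (RDirProd_list Rs) (RDirProd_list Ss)) (RDirProd_list (Rs @ Ss))"
    using Rs(3) Ss(2) RDirProd_list_append[of Rs Ss] unfolding is_ring_iso_def by blast
  from ring_iso_set_trans[OF ring_iso_set_trans[OF corner_add_iso[OF g h gh] RDirProd_iso6[OF this(1,2)]] this(3)]
  have "corner R (g \<oplus> h) \<simeq> RDirProd_list (Rs @ Ss)" unfolding is_ring_iso_def by blast
  then show ?thesis using Rs Ss unfolding decomposable_def by (intro exI[of _ "Rs @ Ss"]) auto
qed

text \<open>Noetherian induction on idempotents: for \<open>g\<close> below \<open>e\<close> the
  ideal of \<open>1 - e\<close> is contained in that of \<open>1 - g\<close>, so a maximal such
  ideal belongs to a minimal counterexample. It has no proper splitting, and the connected case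
  applies.\<close>

lemma idempotents_decomposable:
  assumes noeth: "noetherian_ring R" and gp: "generically_principal R"
    and cic: "completely_integrally_closed R"
    and "d \<in> carrier R" "d \<otimes> d = d" "d \<noteq> \<zero>"
  shows "decomposable d"
proof (rule ccontr)
  assume bad: "\<not> decomposable d"
  define B where "B = {e \<in> carrier R. e \<otimes> e = e \<and> e \<noteq> \<zero> \<and> \<not> decomposable e}"
  have "d \<in> B" using assms bad by (simp add: B_def)
  then have ne: "(\<lambda>e. PIdl (\<one> \<ominus> e)) ` B \<noteq> {}" by blast
  have "ideal I R" if "I \<in> (\<lambda>e. PIdl (\<one> \<ominus> e)) ` B" for I
    using that cgenideal_ideal by (auto simp: B_def)
  then obtain M where M: "M \<in> (\<lambda>e. PIdl (\<one> \<ominus> e)) ` B"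
    "\<And>J. \<lbrakk>J \<in> (\<lambda>e. PIdl (\<one> \<ominus> e)) ` B; M \<subseteq> J\<rbrakk> \<Longrightarrow> J = M"
    using noetherian_ring.maximal_element[OF noeth ne] by metis
  then obtain e where eB: "e \<in> B" and Me: "M = PIdl (\<one> \<ominus> e)" by blast
  then have e: "e \<in> carrier R" "e \<otimes> e = e" "e \<noteq> \<zero>" "\<not> decomposable e" by (auto simp: B_def)
  interpret e: cring_idempotent R e by unfold_locales (use e in auto)
  have part: "decomposable g" if g: "g \<in> carrier R" "e \<otimes> g = g" "g \<otimes> g = g" "g \<noteq> \<zero>" "g \<noteq> e" for g
  proof (rule ccontr)
    assume "\<not> decomposable g"
    then have gB: "PIdl (\<one> \<ominus> g) \<in> (\<lambda>e. PIdl (\<one> \<ominus> e)) ` B" using g by (auto simp: B_def)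
    have ge: "g \<otimes> e = g" using g e(1) by (simp add: m_comm)
    have "\<one> \<ominus> e = (\<one> \<ominus> e) \<otimes> (\<one> \<ominus> g)"
      using g(1,2) e(1) by (simp add: a_minus_def l_distr r_distr l_minus r_minus a_assoc l_neg r_neg)
    then have "\<one> \<ominus> e \<in> PIdl (\<one> \<ominus> g)" using e(1) unfolding cgenideal_def by blast
    then have "M \<subseteq> PIdl (\<one> \<ominus> g)"
      unfolding Me using g(1) by (intro cgenideal_minimal cgenideal_ideal) auto
    then have "PIdl (\<one> \<ominus> g) = PIdl (\<one> \<ominus> e)" using M(2)[OF gB] Me by simp
    then have "\<one> \<ominus> g \<in> PIdl (\<one> \<ominus> e)" using cgenideal_self[of "\<one> \<ominus> g"] g(1) by simp
    then obtain r where r: "r \<in> carrier R" "\<one> \<ominus> g = r \<otimes> (\<one> \<ominus> e)" by (auto simp: cgenideal_def)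
    \<comment> \<open>If the two ideals agree, \<open>e\<close> kills \<open>1 - g\<close>, which
      means \<open>e = g\<close>.\<close>
    have "e \<otimes> (\<one> \<ominus> g) = r \<otimes> (e \<otimes> (\<one> \<ominus> e))" unfolding r(2) using r(1) e(1) by (simp add: m_lcomm)
    also have "\<dots> = \<zero>" using r(1) e(1,2) by (simp add: a_minus_def r_distr r_minus r_neg)
    finally have "e \<ominus> g = \<zero>" using g(1,2) e(1) by (simp add: a_minus_def r_distr r_minus)
    then show False using g e(1) by simp
  qed
  have "g = \<zero> \<or> g = e" if g: "g \<in> carrier R" "e \<otimes> g = g" "g \<otimes> g = g" for g
  proof (rule ccontr)
    assume gn: "\<not> (g = \<zero> \<or> g = e)"
    define h where "h = e \<ominus> g"
    have ge: "g \<otimes> e = g" using g e(1) by (simp add: m_comm)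
    have h: "h \<in> carrier R" "e \<otimes> h = h" "g \<otimes> h = \<zero>"
      using g e(1,2) ge by (simp_all add: h_def a_minus_def r_distr r_minus r_neg)
    have hh: "h \<otimes> h = h"
    proof -
      have "h \<otimes> h = e \<otimes> h \<ominus> g \<otimes> h" using g(1) e(1) by (simp add: h_def a_minus_def l_distr l_minus)
      then show ?thesis using h by (simp add: a_minus_def)
    qed
    have h0: "h \<noteq> \<zero>" using gn g e(1) by (auto simp: h_def)
    have sum: "g \<oplus> h = e" using g(1) e(1) by (simp add: h_def a_minus_def a_lcomm[of g] r_neg)
    have "h \<noteq> e"
    proof
      assume "h = e"
      then have "g \<otimes> e = \<zero>" using h(3) by simp
      then show False using ge gn by simp
    qed
    then have "decomposable h" using part[OF h(1,2) hh h0] by simp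
    moreover have "decomposable g" using part[OF g] gn by simp
    ultimately have "decomposable e" using decomposable_add[OF g(1,3) h(1) hh h(3)] sum by simp
    then show False using e(4) by simp
  qed
  then have "krull_domain (corner R e) \<or> special_primary_ring (corner R e)"
    using e.corner.connected_krull_or_special_primary[OF e.corner_noetherian[OF noeth]
        e.corner_generically_principal[OF gp] e.corner_completely_integrally_closed[OF cic]] e(3)
    by simp
  moreover have "corner R e \<simeq> RDirProd_list [corner R e]"
    using RDirProd_list_iso3[of "corner R e"] unfolding is_ring_iso_def by blast
  ultimately have "decomposable e" unfolding decomposable_def by (intro exI[of _ "[corner R e]"]) simp
  then show False using e(4) by simp
qed

lemma generically_principal_imp_general_krull:
  assumes "noetherian_ring R" "generically_principal R" "completely_integrally_closed R" "\<one> \<noteq> \<zero>"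
  shows "general_krull_ring R"
proof -
  have "decomposable \<one>" using idempotents_decomposable[OF assms(1-3), of \<one>] assms(4) by simp
  then obtain Rs :: "'a ring list" where Rs: "Rs \<noteq> []"
    "\<forall>S \<in> set Rs. krull_domain S \<or> special_primary_ring S" "corner R \<one> \<simeq> RDirProd_list Rs"
    unfolding decomposable_def by blast
  \<comment> \<open>The corner at \<open>\<one>\<close> is \<open>R\<close> itself without possible
    additional record fields.\<close>
  have "id \<in> ring_iso R (corner R \<one>)"
    by (auto intro!: ring_iso_memI simp: bij_betw_def)
  then have "R \<simeq> RDirProd_list Rs"
    using Rs(3) ring_iso_set_trans unfolding is_ring_iso_def by blast
  then show ?thesis using Rs is_cring unfolding general_krull_ring_def by blast
qed

end

theorem theorem6p22:
  fixes R :: "('a, 'b) ring_scheme" (structure)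
  assumes "cring R" and "\<one> \<noteq> \<zero>"
    and "noetherian_ring R"
    and "integrally_closed R"
  shows "general_krull_ring R \<longleftrightarrow> principal_ideal_ring (total_quotient_ring R)"
proof -
  interpret cring R by fact
  have "completely_integrally_closed R"
    using integrally_closed_imp_completely_integrally_closed assms by blast
  then show ?thesis
    unfolding tqr_principal_iff_generically_principal
    using general_krull_imp_generically_principal generically_principal_imp_general_krull assms by blast
qed

end
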